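(* Let $\mathfrak g$ be a complex simple Lie algebra of type $A_\ell$ with $\ell$ odd, $D_\ell$ ($\ell\ge4$), $E_6$, $E_7$ or $E_8$, with (even) Coxeter number $h$, and with $\Delta_+$, $\beta_i$, $\sigma$, $i_\varphi$, $k_\varphi$ as in the context. Let $\varphi\in\Delta_+$. Then there exists a unique positive integer $n(\varphi)$ with $1\le n(\varphi)\le h$, having the same parity as $k_\varphi$, such that $$\sigma^{\frac{n(\varphi)-1}{2}}(\varphi)=\beta_{i_\varphi}\quad\text{if }k_\varphi=1,$$ $$\sigma^{\frac{n(\varphi)}{2}}(\varphi)=\beta_{i_\varphi}\quad\text{if }k_\varphi=2.$$
   Context: Let $\ell$ be the rank of $\mathfrak g$, $I=\{1,\dots,\ell\}$, $\Delta$ the roots of $\mathfrak g$ with respect to a Cartan subalgebra, $\Delta_+$ a choice of positive roots, $\Pi=\{\alpha_i\mid i\in I\}$ the simple roots, $W$ the Weyl group, $\psi$ the highest root, and $h$ the Coxeter number (so $\ell(h+1)=\dim\mathfrak g$). There is a unique partition $\Pi=\Pi_1\cup\Pi_2$, with $\Pi_k=\{\alpha_i\mid i\in I_k\}$ and $I=I_1\sqcup I_2$, such that distinct roots in the same $\Pi_k$ are orthogonal and all roots in $\Pi_2$ are orthogonal to $\psi$ ($\Pi_2$ may be empty, for $A_1$). Let $s_i\in W$ be the reflection in $\alpha_i$, $\tau_k=\prod_{i\in I_k}s_i$ for $k=1,2$, $\sigma=\tau_2\tau_1$ (a Coxeter element), and $Z\subset W$ the cyclic group generated by $\sigma$. Put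 $\beta_i=\alpha_i$ if $i\in I_1$ and $\beta_i=-\alpha_i$ if $i\in I_2$. The set $\Delta_+$ is the disjoint union over $i\in I$ of the sets $(Z\cdot\beta_i)_+=\Delta_+\cap Z\cdot\beta_i$. For $\varphi\in\Delta_+$, $i_\varphi\in I$ is the index with $\varphi\in(Z\cdot\beta_{i_\varphi})_+$, and $k_\varphi\in\{1,2\}$ is the number with $i_\varphi\in I_{k_\varphi}$. *)

theory Defs
  imports Complex_Main
begin

section \<open>Complex Lie algebras and Cartan subalgebras\<close>

class complex_lie_algebra = ab_group_add +
  fixes cscale :: "complex \<Rightarrow> 'a \<Rightarrow> 'a" (infixr \<open>*\<^sub>C\<close> 75)
    and lie_bracket :: "'a \<Rightarrow> 'a \<Rightarrow> 'a"
  assumes cscale_add_right: "c *\<^sub>C (x + y) = c *\<^sub>C x + c *\<^sub>C y"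
    and cscale_add_left: "(c + d) *\<^sub>C x = c *\<^sub>C x + d *\<^sub>C x"
    and cscale_cscale: "c *\<^sub>C d *\<^sub>C x = (c * d) *\<^sub>C x"
    and cscale_one: "1 *\<^sub>C x = x"
    and finite_dim: "\<exists>B. finite B \<and> (\<forall>x. \<exists>c. x = (\<Sum>b\<in>B. c b *\<^sub>C b))"
    and lie_bracket_add_left: "lie_bracket (x + y) z = lie_bracket x z + lie_bracket y z"
    and lie_bracket_add_right: "lie_bracket x (y + z) = lie_bracket x y + lie_bracket x z"
    and lie_bracket_scale_left: "lie_bracket (c *\<^sub>C x) y = c *\<^sub>C lie_bracket x y"
    and lie_bracket_scale_right: "lie_bracket x (c *\<^sub>C y) = c *\<^sub>C lie_bracket x y"
    and lie_bracket_self: "lie_bracket x x = 0"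
    and jacobi: "lie_bracket x (lie_bracket y z) + lie_bracket y (lie_bracket z x)
                   + lie_bracket z (lie_bracket x y) = 0"

definition (in complex_lie_algebra) lie_ideal :: "'a set \<Rightarrow> bool" where
  "lie_ideal J \<longleftrightarrow> 0 \<in> J \<and> (\<forall>x\<in>J. \<forall>y\<in>J. x + y \<in> J) \<and> (\<forall>c. \<forall>x\<in>J. c *\<^sub>C x \<in> J) \<and>
     (\<forall>x. \<forall>y\<in>J. lie_bracket x y \<in> J)"

class simple_complex_lie_algebra = complex_lie_algebra +
  assumes not_abelian: "\<exists>x y. lie_bracket x y \<noteq> 0"
    and simple: "lie_ideal J \<Longrightarrow> J = {0} \<or> J = UNIV"

global_interpretation cscale: vector_space "cscale :: complex \<Rightarrow> 'g::complex_lie_algebra \<Rightarrow> 'g"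
  by unfold_locales (fact cscale_add_right cscale_add_left cscale_cscale cscale_one)+

definition lie_subalgebra :: "'g::complex_lie_algebra set \<Rightarrow> bool" where
  "lie_subalgebra S \<longleftrightarrow> module.subspace cscale S \<and> (\<forall>x\<in>S. \<forall>y\<in>S. lie_bracket x y \<in> S)"

primrec lower_central :: "'g::complex_lie_algebra set \<Rightarrow> nat \<Rightarrow> 'g set" where
  "lower_central S 0 = S"
| "lower_central S (Suc n) =
     module.span cscale {lie_bracket x y | x y. x \<in> S \<and> y \<in> lower_central S n}"

definition lie_nilpotent :: "'g::complex_lie_algebra set \<Rightarrow> bool" where
  "lie_nilpotent S \<longleftrightarrow> (\<exists>n. lower_central S n = {0})"

definition cartan_subalgebra :: "'g::complex_lie_algebra set \<Rightarrow> bool" where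
  "cartan_subalgebra H \<longleftrightarrow>
     lie_subalgebra H \<and> lie_nilpotent H \<and> {x. \<forall>h\<in>H. lie_bracket x h \<in> H} = H"

text \<open>The trace is computed in some basis; it does not depend on which.\<close>

definition some_basis :: "'g::complex_lie_algebra set" where
  "some_basis = (SOME B. \<not> module.dependent cscale B \<and> module.span cscale B = UNIV)"

definition lie_trace :: "('g::complex_lie_algebra \<Rightarrow> 'g) \<Rightarrow> complex" where
  "lie_trace f = (\<Sum>b\<in>some_basis. module.representation cscale some_basis (f b) b)"

definition killing :: "'g::complex_lie_algebra \<Rightarrow> 'g \<Rightarrow> complex" where
  "killing x y = lie_trace (\<lambda>z. lie_bracket x (lie_bracket y z))"


section \<open>Roots\<close>

text \<open>A linear functional on a subspace \<open>H\<close> is represented by a function on the whole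
  algebra vanishing outside \<open>H\<close>, so that equality of functions is equality of functionals.\<close>

definition dual_on :: "'g::complex_lie_algebra set \<Rightarrow> ('g \<Rightarrow> complex) set" where
  "dual_on H = {f. (\<forall>x\<in>H. \<forall>y\<in>H. f (x + y) = f x + f y) \<and>
                   (\<forall>c. \<forall>x\<in>H. f (c *\<^sub>C x) = c * f x) \<and> (\<forall>x. x \<notin> H \<longrightarrow> f x = 0)}"

definition root_space :: "'g::complex_lie_algebra set \<Rightarrow> ('g \<Rightarrow> complex) \<Rightarrow> 'g set" where
  "root_space H \<alpha> = {x. \<forall>h\<in>H. lie_bracket h x = \<alpha> h *\<^sub>C x}"

definition lie_roots :: "'g::complex_lie_algebra set \<Rightarrow> ('g \<Rightarrow> complex) set" where
  "lie_roots H = {\<alpha> \<in> dual_on H. \<alpha> \<noteq> (\<lambda>_. 0) \<and> root_space H \<alpha> \<noteq> {0}}"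

text \<open>The Killing form identifies \<open>H\<close> with its dual; \<open>dual_form\<close> is the form transported
  to the dual. Orthogonality of roots and reflections refer to it.\<close>

definition killing_rep :: "'g::complex_lie_algebra set \<Rightarrow> ('g \<Rightarrow> complex) \<Rightarrow> 'g" where
  "killing_rep H \<mu> = (THE t. t \<in> H \<and> (\<forall>h\<in>H. killing t h = \<mu> h))"

definition dual_form ::
    "'g::complex_lie_algebra set \<Rightarrow> ('g \<Rightarrow> complex) \<Rightarrow> ('g \<Rightarrow> complex) \<Rightarrow> complex" where
  "dual_form H \<mu> \<nu> = killing (killing_rep H \<mu>) (killing_rep H \<nu>)"

definition cartan_int ::
    "'g::complex_lie_algebra set \<Rightarrow> ('g \<Rightarrow> complex) \<Rightarrow> ('g \<Rightarrow> complex) \<Rightarrow> complex" where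
  "cartan_int H \<mu> \<alpha> = 2 * dual_form H \<mu> \<alpha> / dual_form H \<alpha> \<alpha>"

definition root_reflection ::
    "'g::complex_lie_algebra set \<Rightarrow> ('g \<Rightarrow> complex) \<Rightarrow> ('g \<Rightarrow> complex) \<Rightarrow> ('g \<Rightarrow> complex)" where
  "root_reflection H \<alpha> \<mu> = (\<lambda>h. \<mu> h - cartan_int H \<mu> \<alpha> * \<alpha> h)"

definition int_comb :: "nat \<Rightarrow> (nat \<Rightarrow> 'g \<Rightarrow> complex) \<Rightarrow> (nat \<Rightarrow> int) \<Rightarrow> ('g \<Rightarrow> complex)" where
  "int_comb l \<alpha> c = (\<lambda>h. \<Sum>i\<in>{1..l}. of_int (c i) * \<alpha> i h)"

definition indep_family :: "nat \<Rightarrow> (nat \<Rightarrow> 'g \<Rightarrow> complex) \<Rightarrow> bool" where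
  "indep_family l \<alpha> \<longleftrightarrow>
     (\<forall>c :: nat \<Rightarrow> complex. (\<forall>h. (\<Sum>i\<in>{1..l}. c i * \<alpha> i h) = 0) \<longrightarrow> (\<forall>i\<in>{1..l}. c i = 0))"

text \<open>A choice of positive roots is given by its family of simple roots
  \<open>\<alpha> 1, \<dots>, \<alpha> l\<close>.\<close>

definition is_base :: "'g::complex_lie_algebra set \<Rightarrow> nat \<Rightarrow> (nat \<Rightarrow> 'g \<Rightarrow> complex) \<Rightarrow> bool" where
  "is_base H l \<alpha> \<longleftrightarrow>
     (\<forall>i\<in>{1..l}. \<alpha> i \<in> lie_roots H) \<and> indep_family l \<alpha> \<and>
     (\<forall>\<beta>\<in>lie_roots H. \<exists>c. \<beta> = int_comb l \<alpha> c \<and>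
        ((\<forall>i\<in>{1..l}. 0 \<le> c i) \<or> (\<forall>i\<in>{1..l}. c i \<le> 0)))"

definition positive_roots ::
    "'g::complex_lie_algebra set \<Rightarrow> nat \<Rightarrow> (nat \<Rightarrow> 'g \<Rightarrow> complex) \<Rightarrow> ('g \<Rightarrow> complex) set" where
  "positive_roots H l \<alpha> =
     {\<beta> \<in> lie_roots H. \<exists>c. (\<forall>i\<in>{1..l}. 0 \<le> c i) \<and> \<beta> = int_comb l \<alpha> c}"

definition is_highest_root ::
    "'g::complex_lie_algebra set \<Rightarrow> nat \<Rightarrow> (nat \<Rightarrow> 'g \<Rightarrow> complex) \<Rightarrow> ('g \<Rightarrow> complex) \<Rightarrow> bool" where
  "is_highest_root H l \<alpha> \<psi> \<longleftrightarrow> \<psi> \<in> lie_roots H \<and>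
     (\<forall>\<beta>\<in>lie_roots H. \<exists>c. (\<forall>i\<in>{1..l}. 0 \<le> c i) \<and> (\<lambda>h. \<psi> h - \<beta> h) = int_comb l \<alpha> c)"


section \<open>Types A, D, E\<close>

datatype dynkin_type = Type_A nat | Type_D nat | Type_E nat

primrec dynkin_rank :: "dynkin_type \<Rightarrow> nat" where
  "dynkin_rank (Type_A l) = l"
| "dynkin_rank (Type_D l) = l"
| "dynkin_rank (Type_E l) = l"

text \<open>Edges \<open>i \<midarrow> j\<close> with \<open>i < j\<close> of the Dynkin diagram on \<open>{1..l}\<close>, in Bourbaki's labelling.\<close>

primrec dynkin_edge :: "dynkin_type \<Rightarrow> nat \<Rightarrow> nat \<Rightarrow> bool" where
  "dynkin_edge (Type_A l) i j \<longleftrightarrow> 1 \<le> i \<and> j = i + 1 \<and> j \<le> l"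
| "dynkin_edge (Type_D l) i j \<longleftrightarrow> (1 \<le> i \<and> j = i + 1 \<and> j \<le> l - 1) \<or> (i = l - 2 \<and> j = l)"
| "dynkin_edge (Type_E l) i j \<longleftrightarrow>
     (i = 1 \<and> j = 3) \<or> (i = 2 \<and> j = 4) \<or> (3 \<le> i \<and> j = i + 1 \<and> j \<le> l)"

definition cartan_matrix :: "dynkin_type \<Rightarrow> nat \<Rightarrow> nat \<Rightarrow> int" where
  "cartan_matrix X i j =
     (if i = j then 2 else if dynkin_edge X i j \<or> dynkin_edge X j i then -1 else 0)"

text \<open>The abstract root system of type \<open>X\<close>, in coordinates with respect to its simple roots:
  the orbit of the simple roots under the Weyl group. The invariant form is normalised so that
  its Gram matrix on the simple roots is the (symmetric) Cartan matrix.\<close>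

definition std_form :: "dynkin_type \<Rightarrow> (nat \<Rightarrow> int) \<Rightarrow> (nat \<Rightarrow> int) \<Rightarrow> int" where
  "std_form X c d =
     (\<Sum>i\<in>{1..dynkin_rank X}. \<Sum>j\<in>{1..dynkin_rank X}. c i * cartan_matrix X i j * d j)"

definition unit_vec :: "nat \<Rightarrow> nat \<Rightarrow> int" where
  "unit_vec i = (\<lambda>j. if j = i then 1 else 0)"

inductive_set std_roots :: "dynkin_type \<Rightarrow> (nat \<Rightarrow> int) set" for X where
  simple_root: "i \<in> {1..dynkin_rank X} \<Longrightarrow> unit_vec i \<in> std_roots X"
| simple_reflection: "c \<in> std_roots X \<Longrightarrow> i \<in> {1..dynkin_rank X} \<Longrightarrow>
     (\<lambda>j. c j - std_form X c (unit_vec i) * unit_vec i j) \<in> std_roots X"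

text \<open>The algebra has type \<open>X\<close> (with respect to \<open>H\<close>) if its root system is isomorphic to
  the one of type \<open>X\<close>: a linear isomorphism of the spans, sending the standard simple roots to
  the family \<open>a\<close>, maps roots onto roots and preserves the numbers \<open>2 (\<mu>,\<alpha>) / (\<alpha>,\<alpha>)\<close>.\<close>

definition has_type :: "'g::complex_lie_algebra set \<Rightarrow> dynkin_type \<Rightarrow> bool" where
  "has_type H X \<longleftrightarrow> (\<exists>a. indep_family (dynkin_rank X) a \<and>
     lie_roots H = int_comb (dynkin_rank X) a ` std_roots X \<and>
     (\<forall>c\<in>std_roots X. \<forall>d\<in>std_roots X.
        cartan_int H (int_comb (dynkin_rank X) a c) (int_comb (dynkin_rank X) a d)
          = 2 * of_int (std_form X c d) / of_int (std_form X d d)))"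


section \<open>The Coxeter element of the bipartition\<close>

definition is_bipartition :: "'g::complex_lie_algebra set \<Rightarrow> nat \<Rightarrow> (nat \<Rightarrow> 'g \<Rightarrow> complex) \<Rightarrow>
    ('g \<Rightarrow> complex) \<Rightarrow> nat set \<Rightarrow> nat set \<Rightarrow> bool" where
  "is_bipartition H l \<alpha> \<psi> I1 I2 \<longleftrightarrow>
     I1 \<union> I2 = {1..l} \<and> I1 \<inter> I2 = {} \<and>
     (\<forall>i\<in>I1. \<forall>j\<in>I1. i \<noteq> j \<longrightarrow> dual_form H (\<alpha> i) (\<alpha> j) = 0) \<and>
     (\<forall>i\<in>I2. \<forall>j\<in>I2. i \<noteq> j \<longrightarrow> dual_form H (\<alpha> i) (\<alpha> j) = 0) \<and>
     (\<forall>i\<in>I2. dual_form H (\<alpha> i) \<psi> = 0)"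

text \<open>The product of the simple reflections in \<open>S\<close>, taken in increasing order of the indices;
  it is only used for sets \<open>S\<close> whose reflections commute.\<close>

definition reflection_prod :: "'g::complex_lie_algebra set \<Rightarrow> (nat \<Rightarrow> 'g \<Rightarrow> complex) \<Rightarrow>
    nat set \<Rightarrow> ('g \<Rightarrow> complex) \<Rightarrow> ('g \<Rightarrow> complex)" where
  "reflection_prod H \<alpha> S =
     foldr (\<lambda>i f. root_reflection H (\<alpha> i) \<circ> f) (sorted_list_of_set S) id"

definition coxeter_elt :: "'g::complex_lie_algebra set \<Rightarrow> (nat \<Rightarrow> 'g \<Rightarrow> complex) \<Rightarrow>
    nat set \<Rightarrow> nat set \<Rightarrow> ('g \<Rightarrow> complex) \<Rightarrow> ('g \<Rightarrow> complex)" where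
  "coxeter_elt H \<alpha> I1 I2 = reflection_prod H \<alpha> I2 \<circ> reflection_prod H \<alpha> I1"

text \<open>The Coxeter number is the order of the Coxeter element, the Weyl group being regarded
  as a group of permutations of the roots (on which it acts faithfully).\<close>

definition coxeter_number :: "'g::complex_lie_algebra set \<Rightarrow> (nat \<Rightarrow> 'g \<Rightarrow> complex) \<Rightarrow>
    nat set \<Rightarrow> nat set \<Rightarrow> nat" where
  "coxeter_number H \<alpha> I1 I2 =
     (LEAST m. 0 < m \<and> (\<forall>\<phi>\<in>lie_roots H. (coxeter_elt H \<alpha> I1 I2 ^^ m) \<phi> = \<phi>))"

definition beta :: "(nat \<Rightarrow> 'g \<Rightarrow> complex) \<Rightarrow> nat set \<Rightarrow> nat \<Rightarrow> ('g \<Rightarrow> complex)" where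
  "beta \<alpha> I1 i = (if i \<in> I1 then \<alpha> i else (\<lambda>h. - \<alpha> i h))"

text \<open>Orbit under the cyclic group generated by a bijection \<open>s\<close>; the second disjunct accounts
  for the negative powers.\<close>

definition cyclic_orbit :: "('b \<Rightarrow> 'b) \<Rightarrow> 'b \<Rightarrow> 'b set" where
  "cyclic_orbit s x = {y. \<exists>m. y = (s ^^ m) x \<or> (s ^^ m) y = x}"

definition root_index :: "'g::complex_lie_algebra set \<Rightarrow> nat \<Rightarrow> (nat \<Rightarrow> 'g \<Rightarrow> complex) \<Rightarrow>
    nat set \<Rightarrow> nat set \<Rightarrow> ('g \<Rightarrow> complex) \<Rightarrow> nat" where
  "root_index H l \<alpha> I1 I2 \<phi> =
     (THE i. i \<in> {1..l} \<and>
        \<phi> \<in> positive_roots H l \<alpha> \<inter> cyclic_orbit (coxeter_elt H \<alpha> I1 I2) (beta \<alpha> I1 i))"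

definition root_colour :: "'g::complex_lie_algebra set \<Rightarrow> nat \<Rightarrow> (nat \<Rightarrow> 'g \<Rightarrow> complex) \<Rightarrow>
    nat set \<Rightarrow> nat set \<Rightarrow> ('g \<Rightarrow> complex) \<Rightarrow> nat" where
  "root_colour H l \<alpha> I1 I2 \<phi> = (if root_index H l \<alpha> I1 I2 \<phi> \<in> I1 then 1 else 2)"

end

theory Submission
  imports Defs "HOL-Analysis.Function_Topology"
begin

text \<open>Record a root by its coefficients in the base, split along the colours as a pair
  \<open>(c\<^sub>1, c\<^sub>2)\<close>. With \<open>A = 2 - \<close> Gram matrix, the reflections \<open>\<tau>\<^sub>1, \<tau>\<^sub>2\<close> applied alternately
  produce a sequence \<open>Z\<^sub>t\<close> with \<open>Z\<^sub>t\<^sub>+\<^sub>2 = A Z\<^sub>t\<^sub>+\<^sub>1 - Z\<^sub>t\<close> in which every pair of consecutive terms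
  is a root. As roots have coefficients of one sign, the sign of the sequence can only change at an
  exact zero \<open>Z\<^sub>n = 0\<close>, and then \<open>Z\<^sub>n\<^sub>-\<^sub>1 = -Z\<^sub>n\<^sub>+\<^sub>1\<close> is a simple root. Pairing with a Perron-Frobenius
  eigenvector of \<open>A\<close> turns all these sequences into solutions of one scalar recurrence, so the
  distance \<open>T\<close> between consecutive zeros is the same for all roots. Running a sequence backwards
  from its zero shows that \<open>Z\<close> has period \<open>2T\<close>; hence \<open>T\<close> is the order of \<open>\<sigma>\<close>, and \<open>n(\<phi>)\<close> is
  the position of the first zero of the sequence of \<open>\<phi>\<close>. The highest root ensures irreducibility
  and that the eigenvalue is less than 2.\<close>

section \<open>A Perron-Frobenius eigenvector\<close>

text \<open>A quadratic in \<open>t\<close> that vanishes at 0 and is nowhere negative has a minimum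
  at 0, so its linear coefficient is 0. This supplies the first-order condition at the maximiser of
  a Rayleigh quotient.\<close>

lemma linear_coeff_zero_if_nonneg:
  fixes b c :: real
  assumes "\<And>t. 0 \<le> 2 * t * b + t\<^sup>2 * c"
  shows "b = 0"
proof (rule ccontr)
  assume "b \<noteq> 0"
  define d where "d = \<bar>c\<bar> + 1"
  have d: "0 < d" "c < 2 * d" by (auto simp: d_def)
  have "2 * (- b / d) * b + (- b / d)\<^sup>2 * c = b\<^sup>2 * (c - 2 * d) / d\<^sup>2"
    using d by (simp add: field_simps power2_eq_square)
  also have "\<dots> < 0"
    using \<open>b \<noteq> 0\<close> d by (intro divide_neg_pos mult_pos_neg) auto
  finally show False
    using assms[of "- b / d"] by linarith
qed

text \<open>By Tychonoff: functions carry the product topology, the bounds at every index (also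
  outside \<open>I\<close>) give a compact cube, and the sphere equation over \<open>I\<close> cuts
  out a closed subset.\<close>

lemma compact_nonneg_sphere:
  assumes "finite I"
  shows "compact {x :: 'i \<Rightarrow> real. (\<forall>i. 0 \<le> x i \<and> x i \<le> 1) \<and> (\<Sum>i\<in>I. (x i)\<^sup>2) = 1}"
proof -
  have "compactin (product_topology (\<lambda>_. euclidean) UNIV) (PiE UNIV (\<lambda>_::'i. {0..1::real}))"
    by (simp add: compactin_PiE)
  then have "compact (PiE UNIV (\<lambda>_::'i. {0..1::real}))"
    by (simp add: euclidean_product_topology)
  moreover have "closed {x :: 'i \<Rightarrow> real. (\<Sum>i\<in>I. (x i)\<^sup>2) = 1}"
    by (intro closed_Collect_eq continuous_intros continuous_on_product_coordinates)
  ultimately have "compact (PiE UNIV (\<lambda>_::'i. {0..1::real}) \<inter> {x. (\<Sum>i\<in>I. (x i)\<^sup>2) = 1})"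
    by (rule compact_Int_closed)
  moreover have "PiE UNIV (\<lambda>_::'i. {0..1::real}) \<inter> {x. (\<Sum>i\<in>I. (x i)\<^sup>2) = 1}
      = {x. (\<forall>i. 0 \<le> x i \<and> x i \<le> 1) \<and> (\<Sum>i\<in>I. (x i)\<^sup>2) = 1}"
    by (auto simp: PiE_iff)
  ultimately show ?thesis by simp
qed

text \<open>A maximiser of the quadratic form on the nonnegative part of the unit sphere is a
  critical point, hence an eigenvector. Irreducibility then excludes zero entries.\<close>

lemma perron_frobenius_symmetric:
  fixes A :: "'i \<Rightarrow> 'i \<Rightarrow> real"
  assumes fin: "finite I" and ne: "I \<noteq> {}"
    and sym: "\<And>i j. i \<in> I \<Longrightarrow> j \<in> I \<Longrightarrow> A i j = A j i"
    and nonneg: "\<And>i j. i \<in> I \<Longrightarrow> j \<in> I \<Longrightarrow> 0 \<le> A i j"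
    and irred: "\<And>J. J \<subset> I \<Longrightarrow> J \<noteq> {} \<Longrightarrow> \<exists>i\<in>J. \<exists>j\<in>I - J. A i j \<noteq> 0"
  obtains x \<mu> where "\<And>i. i \<in> I \<Longrightarrow> 0 < x i"
    and "\<And>i. i \<in> I \<Longrightarrow> (\<Sum>j\<in>I. A i j * x j) = \<mu> * x i"
proof -
  define Q where "Q x = (\<Sum>i\<in>I. \<Sum>j\<in>I. A i j * x i * x j)" for x
  define N where "N x = (\<Sum>i\<in>I. (x i)\<^sup>2)" for x :: "'i \<Rightarrow> real"
  define K where "K = {x :: 'i \<Rightarrow> real. (\<forall>i. 0 \<le> x i \<and> x i \<le> 1) \<and> N x = 1}"
  obtain k where k: "k \<in> I" using ne by auto
  have "(\<lambda>i. if i = k then 1 else 0) \<in> K"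
    using k fin by (auto simp: K_def N_def if_distrib[of "\<lambda>x. x\<^sup>2"] cong: if_cong)
  moreover have "compact K"
    unfolding K_def N_def using fin by (rule compact_nonneg_sphere)
  moreover have "continuous_on K Q"
    by (rule continuous_on_subset[of UNIV])
      (auto simp: Q_def intro!: continuous_intros continuous_on_product_coordinates)
  ultimately obtain x where xK: "x \<in> K" and xmax: "\<And>y. y \<in> K \<Longrightarrow> Q y \<le> Q x"
    using continuous_attains_sup[of K Q] by blast
  define \<mu> where "\<mu> = Q x"
  have bound: "Q y \<le> \<mu> * N y" for y
  proof (cases "N y = 0")
    case True
    then have "\<forall>i\<in>I. y i = 0"
      using fin by (simp add: N_def sum_nonneg_eq_0_iff)
    then show ?thesis by (simp add: True Q_def)
  next
    case False
    then have pos: "0 < N y"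
      by (simp add: N_def less_le sum_nonneg)
    \<comment> \<open>Taking absolute values does not decrease \<open>Q\<close>, as the entries of
      \<open>A\<close> are nonnegative. So the maximum over \<open>K\<close> bounds the Rayleigh
      quotient of vectors with entries of any sign.\<close>
    define z where "z i = (if i \<in> I then \<bar>y i\<bar> / sqrt (N y) else 0)" for i
    have le: "(y i)\<^sup>2 \<le> N y" if "i \<in> I" for i
      unfolding N_def using that fin by (intro member_le_sum) auto
    have "z i \<le> 1" for i
      using pos le[of i] real_le_rsqrt[of "\<bar>y i\<bar>" "N y"] by (simp add: z_def)
    moreover have "N z = 1"
    proof -
      have "N z = (\<Sum>i\<in>I. (y i)\<^sup>2 / N y)"
        unfolding N_def[of z] using pos by (intro sum.cong) (auto simp: z_def power_divide)
      then show ?thesis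
        using pos by (simp add: N_def sum_divide_distrib[symmetric])
    qed
    ultimately have "z \<in> K"
      using pos by (auto simp: K_def z_def)
    have "Q y \<le> (\<Sum>i\<in>I. \<Sum>j\<in>I. A i j * \<bar>y i\<bar> * \<bar>y j\<bar>)"
      unfolding Q_def mult.assoc abs_mult[symmetric]
      by (intro sum_mono mult_left_mono nonneg) auto
    also have "\<dots> = N y * Q z"
      unfolding Q_def sum_distrib_left using pos
      by (intro sum.cong refl) (simp add: z_def)
    also have "\<dots> \<le> N y * \<mu>"
      unfolding \<mu>_def using xmax[OF \<open>z \<in> K\<close>] pos by (intro mult_left_mono) auto
    finally show ?thesis by (simp add: mult.commute)
  qed
  have eigen: "(\<Sum>j\<in>I. A i j * x j) = \<mu> * x i" if i: "i \<in> I" for i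
  proof -
    let ?Ax = "\<Sum>j\<in>I. A i j * x j"
    \<comment> \<open>Perturb the maximiser by \<open>t\<close> in coordinate \<open>i\<close>. The
      perturbed vector may have a negative entry, which \<open>bound\<close> allows.\<close>
    have "0 \<le> 2 * t * (\<mu> * x i - ?Ax) + t\<^sup>2 * (\<mu> - A i i)" for t
    proof -
      let ?e = "\<lambda>j. if j = i then t else 0"
      let ?y = "\<lambda>j. x j + ?e j"
      have Ax': "(\<Sum>j\<in>I. A j i * x j) = ?Ax"
        using i by (intro sum.cong) (auto simp: sym)
      have D: "(\<Sum>j\<in>I. g j * ?e j) = g i * t" for g :: "'i \<Rightarrow> real"
      proof -
        have "(\<Sum>j\<in>I. g j * ?e j) = (\<Sum>j\<in>I. if j = i then g j * t else 0)"
          by (intro sum.cong) auto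
        then show ?thesis using fin i by simp
      qed
      have "Q ?y = Q x + (\<Sum>j\<in>I. \<Sum>k\<in>I. A j k * x j * ?e k)
          + (\<Sum>k\<in>I. \<Sum>j\<in>I. A j k * x k * ?e j) + (\<Sum>j\<in>I. (\<Sum>k\<in>I. A j k * ?e k) * ?e j)"
        unfolding Q_def sum_distrib_right sum.swap[of "\<lambda>k j. A j k * x k * ?e j"] sum.distrib[symmetric]
        by (intro sum.cong refl) (simp add: distrib_left distrib_right mult_ac)
      also have "(\<Sum>j\<in>I. \<Sum>k\<in>I. A j k * x j * ?e k) = t * ?Ax"
        unfolding D Ax'[symmetric] sum_distrib_left by (intro sum.cong refl) simp
      also have "(\<Sum>k\<in>I. \<Sum>j\<in>I. A j k * x k * ?e j) = t * ?Ax"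
        unfolding D sum_distrib_left by (intro sum.cong refl) simp
      also have "(\<Sum>j\<in>I. (\<Sum>k\<in>I. A j k * ?e k) * ?e j) = t\<^sup>2 * A i i"
        unfolding D by (simp add: power2_eq_square)
      finally have Qy: "Q ?y = \<mu> + 2 * t * ?Ax + t\<^sup>2 * A i i"
        by (simp add: \<mu>_def)
      have "N ?y = N x + (\<Sum>j\<in>I. 2 * x j * ?e j) + (\<Sum>j\<in>I. ?e j * ?e j)"
        unfolding N_def sum.distrib[symmetric]
        by (intro sum.cong refl) (simp add: power2_eq_square algebra_simps)
      also have "\<dots> = 1 + 2 * t * x i + t\<^sup>2"
        unfolding D using xK by (simp add: K_def power2_eq_square)
      finally show ?thesis
        using bound[of ?y] Qy by (simp add: algebra_simps)
    qed
    then show ?thesis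
      using linear_coeff_zero_if_nonneg by fastforce
  qed
  have "0 < x i" if "i \<in> I" for i
  proof -
    let ?J = "{j \<in> I. x j \<noteq> 0}"
    have x0: "0 \<le> x j" for j using xK by (simp add: K_def)
    have "?J \<noteq> {}"
    proof
      assume "?J = {}"
      then have "N x = 0" by (simp add: N_def)
      then show False using xK by (simp add: K_def)
    qed
    have "?J = I"
    proof (rule ccontr)
      assume "?J \<noteq> I"
      then obtain j k where jk: "j \<in> I" "x j \<noteq> 0" "k \<in> I" "x k = 0" "A j k \<noteq> 0"
        using irred[of ?J] \<open>?J \<noteq> {}\<close> by blast
      \<comment> \<open>At an index \<open>k\<close> where \<open>x\<close> vanishes, next to the
        support, the eigenvalue equation has 0 on the right but a positive summand on the
        left.\<close>
      have "A k j * x j \<le> (\<Sum>j\<in>I. A k j * x j)"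
        using fin jk nonneg x0 by (intro member_le_sum) auto
      moreover have "0 < A k j * x j"
        using jk nonneg[of j k] sym[of j k] x0[of j] by (intro mult_pos_pos) (auto simp: less_le)
      ultimately show False
        using eigen[of k] jk by simp
    qed
    then show ?thesis
      using that x0[of i] by (force simp: less_le)
  qed
  with eigen show ?thesis using that by blast
qed


section \<open>Root systems with a bipartite base\<close>

text \<open>The slopes \<open>d\<close> satisfy
  \<open>d (t+1) - d t = - (2 - \<mu>) * z (t+1)\<close>, so the sequence is concave where it is
  nonnegative. A negative slope would push it below 0, hence it is nondecreasing; and if
  \<open>z 1 > 0\<close>, every step lowers the slope by at least \<open>(2 - \<mu>) * z 1\<close>,
  until it is negative.\<close>

lemma recurrence_nonneg_imp_zero:
  fixes z :: "nat \<Rightarrow> real"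
  assumes \<mu>: "\<mu> < 2" and rec: "\<And>t. z (Suc (Suc t)) = \<mu> * z (Suc t) - z t"
    and nonneg: "\<And>t. 0 \<le> z t"
  shows "z 0 = 0 \<and> z 1 = 0"
proof -
  define d where "d t = z (Suc t) - z t" for t
  have d_Suc: "d (Suc t) = d t - (2 - \<mu>) * z (Suc t)" for t
    by (simp add: d_def rec algebra_simps)
  have dec: "d (t + s) \<le> d t" for t s
  proof (induction s)
    case (Suc s)
    have "0 \<le> (2 - \<mu>) * z (Suc (t + s))" using \<mu> nonneg by simp
    then show ?case using Suc d_Suc[of "t + s"] by simp
  qed simp
  have d_nonneg: "0 \<le> d t" for t
  proof (rule ccontr)
    assume neg: "\<not> 0 \<le> d t"
    have le: "z (t + s) \<le> z t + of_nat s * d t" for s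
    proof (induction s)
      case (Suc s)
      then show ?case using dec[of t s] by (simp add: d_def algebra_simps)
    qed simp
    obtain s where "z t < of_nat s * (- d t)"
      using neg reals_Archimedean3[of "- d t"] by auto
    then show False using le[of s] nonneg[of "t + s"] by simp
  qed
  have "\<not> 0 < z 1"
  proof
    assume pos: "0 < z 1"
    have ge: "z 1 \<le> z (Suc s)" for s
    proof (induction s)
      case (Suc s)
      then show ?case using d_nonneg[of "Suc s"] by (simp add: d_def)
    qed simp
    have le: "d s \<le> d 0 - of_nat s * ((2 - \<mu>) * z 1)" for s
    proof (induction s)
      case (Suc s)
      have "(2 - \<mu>) * z 1 \<le> (2 - \<mu>) * z (Suc s)"
        using \<mu> ge[of s] by (intro mult_left_mono) auto
      then show ?case using Suc d_Suc[of s] by (simp add: algebra_simps)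
    qed simp
    obtain s where "d 0 < of_nat s * ((2 - \<mu>) * z 1)"
      using pos \<mu> reals_Archimedean3[of "(2 - \<mu>) * z 1"] by auto
    then show False using le[of s] d_nonneg[of s] by simp
  qed
  then have "z 1 = 0" using nonneg[of 1] by simp
  then show ?thesis using rec[of 0] nonneg[of 0] nonneg[of 2] by (simp add: numeral_2_eq_2)
qed

text \<open>Coefficient vectors are total functions on indices. Demanding 0 outside the index set
  makes equality of functions agree with equality of vectors.\<close>

definition supported_on :: "'i set \<Rightarrow> ('i \<Rightarrow> int) \<Rightarrow> bool" where
  "supported_on S c \<longleftrightarrow> (\<forall>i. i \<notin> S \<longrightarrow> c i = 0)"

definition restrict_to :: "'i set \<Rightarrow> ('i \<Rightarrow> int) \<Rightarrow> 'i \<Rightarrow> int" where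
  "restrict_to S c = (\<lambda>i. if i \<in> S then c i else 0)"

lemma unit_vec_apply: "unit_vec i j = (if j = i then 1 else 0)"
  by (simp add: unit_vec_def)

lemma supported_on_unit_vec: "j \<in> S \<Longrightarrow> supported_on S (unit_vec j)"
  by (auto simp: supported_on_def unit_vec_apply)

text \<open>A simply laced root system in coefficients with respect to a base. The form with Gram
  matrix \<open>G\<close> is scaled so that roots have norm 2; its value on a root and a simple root
  is then the Cartan integer, and reflections need no division.\<close>

locale bipartite_roots =
  fixes I1 I2 :: "nat set" and G :: "nat \<Rightarrow> nat \<Rightarrow> int"
    and R :: "(nat \<Rightarrow> int) set" and \<psi> :: "nat \<Rightarrow> int"
  assumes finite_index: "finite (I1 \<union> I2)" and disjoint: "I1 \<inter> I2 = {}"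
    and gram_sym: "\<And>i j. G i j = G j i"
    and gram_diag: "\<And>i. i \<in> I1 \<union> I2 \<Longrightarrow> G i i = 2"
    and orth1: "\<And>i j. i \<in> I1 \<Longrightarrow> j \<in> I1 \<Longrightarrow> i \<noteq> j \<Longrightarrow> G i j = 0"
    and orth2: "\<And>i j. i \<in> I2 \<Longrightarrow> j \<in> I2 \<Longrightarrow> i \<noteq> j \<Longrightarrow> G i j = 0"
    and supported: "\<And>c. c \<in> R \<Longrightarrow> supported_on (I1 \<union> I2) c"
    and coherent: "\<And>c. c \<in> R \<Longrightarrow> (\<forall>i. 0 \<le> c i) \<or> (\<forall>i. c i \<le> 0)"
    and norm: "\<And>c. c \<in> R \<Longrightarrow> (\<Sum>i\<in>I1 \<union> I2. (\<Sum>k\<in>I1 \<union> I2. c k * G k i) * c i) = 2"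
    and simple: "\<And>i. i \<in> I1 \<union> I2 \<Longrightarrow> unit_vec i \<in> R"
    and reflection: "\<And>c i. c \<in> R \<Longrightarrow> i \<in> I1 \<union> I2 \<Longrightarrow>
      (\<lambda>j. c j - (\<Sum>k\<in>I1 \<union> I2. c k * G k i) * unit_vec i j) \<in> R"
    and uminus: "\<And>c. c \<in> R \<Longrightarrow> (\<lambda>j. - c j) \<in> R"
    and highest_root: "\<psi> \<in> R" and highest: "\<And>c i. c \<in> R \<Longrightarrow> c i \<le> \<psi> i"
begin

abbreviation I where "I \<equiv> I1 \<union> I2"

definition pairing where "pairing c i = (\<Sum>k\<in>I. c k * G k i)"

text \<open>The matrix 2 minus the Gram matrix, that is, the adjacency matrix of the Dynkin diagram;
  0 outside \<open>I\<close> keeps the result supported on \<open>I\<close>.\<close>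

definition adj where "adj c i = (if i \<in> I then 2 * c i - pairing c i else 0)"

text \<open>All reflections in \<open>S\<close> carried out simultaneously; for orthogonal
  \<open>S\<close> this is their product.\<close>

definition refl_set where "refl_set S c = (\<lambda>i. if i \<in> S then c i - pairing c i else c i)"

definition orthogonal_set where
  "orthogonal_set S \<longleftrightarrow> S \<subseteq> I \<and> (\<forall>i\<in>S. \<forall>j\<in>S. i \<noteq> j \<longrightarrow> G i j = 0)"

lemma orthogonal_I1: "orthogonal_set I1" and orthogonal_I2: "orthogonal_set I2"
  using orth1 orth2 by (auto simp: orthogonal_set_def)

lemma reflection': "c \<in> R \<Longrightarrow> i \<in> I \<Longrightarrow> (\<lambda>j. c j - pairing c i * unit_vec i j) \<in> R"
  using reflection by (simp add: pairing_def)

lemma norm': "c \<in> R \<Longrightarrow> (\<Sum>i\<in>I. pairing c i * c i) = 2"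
  using norm by (simp add: pairing_def)

lemma pairing_unit_vec: "j \<in> I \<Longrightarrow> pairing (unit_vec j) i = G j i"
proof -
  assume "j \<in> I"
  have "pairing (unit_vec j) i = (\<Sum>k\<in>I. if k = j then G k i else 0)"
    unfolding pairing_def unit_vec_apply by (intro sum.cong) auto
  then show ?thesis using \<open>j \<in> I\<close> finite_index by simp
qed

lemma pairing_add: "pairing (\<lambda>i. c i + d i) = (\<lambda>i. pairing c i + pairing d i)"
  by (auto simp: pairing_def sum.distrib distrib_right)

lemma pairing_uminus: "pairing (\<lambda>i. - c i) = (\<lambda>i. - pairing c i)"
  by (auto simp: pairing_def sum_negf)

lemma pairing_orthogonal:
  assumes "orthogonal_set S" "supported_on S c" "i \<in> S"
  shows "pairing c i = 2 * c i"
proof -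
  have "pairing c i = (\<Sum>k\<in>I. if k = i then 2 * c k else 0)"
    unfolding pairing_def using assms gram_diag
    by (intro sum.cong) (auto simp: orthogonal_set_def supported_on_def)
  then show ?thesis using assms finite_index by (auto simp: orthogonal_set_def)
qed

text \<open>On an orthogonal set of simple roots the form is twice the sum of squares of the
  coefficients. Norm 2 therefore leaves room for a single coefficient, equal to 1.\<close>

lemma orthogonal_supported_root:
  assumes c: "c \<in> R" "\<And>i. 0 \<le> c i" and S: "orthogonal_set S" "supported_on S c"
  shows "\<exists>j\<in>S. c = unit_vec j"
proof -
  have SI: "S \<subseteq> I" and fS: "finite S"
    using S finite_index by (auto simp: orthogonal_set_def intro: finite_subset)
  have "(\<Sum>i\<in>I. pairing c i * c i) = (\<Sum>i\<in>S. 2 * (c i)\<^sup>2)"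
    using S SI finite_index pairing_orthogonal[OF S]
    by (intro sum.mono_neutral_cong_right) (auto simp: supported_on_def power2_eq_square)
  then have one: "(\<Sum>i\<in>S. (c i)\<^sup>2) = 1"
    using norm'[OF c(1)] by (simp add: sum_distrib_left[symmetric])
  then obtain j where j: "j \<in> S" "c j \<noteq> 0"
    by (metis (mono_tags, lifting) sum.neutral zero_neq_one zero_power2)
  have "(\<Sum>i\<in>S. (c i)\<^sup>2) = (c j)\<^sup>2 + (\<Sum>i\<in>S - {j}. (c i)\<^sup>2)"
    using j fS by (simp add: sum.remove)
  moreover have "1 \<le> c j" using j c(2)[of j] by simp
  then have "1 \<le> (c j)\<^sup>2" by simp
  moreover have "0 \<le> (\<Sum>i\<in>S - {j}. (c i)\<^sup>2)" by (simp add: sum_nonneg)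
  ultimately have sq: "(c j)\<^sup>2 = 1" and rest: "(\<Sum>i\<in>S - {j}. (c i)\<^sup>2) = 0"
    using one by linarith+
  have "c j = 1" using sq \<open>1 \<le> c j\<close> by (simp add: power2_eq_1_iff)
  moreover have "c i = 0" if "i \<noteq> j" for i
    using rest fS that S(2) by (cases "i \<in> S") (auto simp: sum_nonneg_eq_0_iff supported_on_def)
  ultimately have "c = unit_vec j" by (auto simp: unit_vec_apply)
  with j show ?thesis by auto
qed

text \<open>The reflection alters only the coefficient at \<open>i\<close>. A positive root other
  than the simple root \<open>i\<close> has a positive coefficient elsewhere, which survives and
  fixes the sign of the reflected root.\<close>

lemma reflection_nonneg:
  assumes c: "c \<in> R" "\<And>i. 0 \<le> c i" and i: "i \<in> I" and ne: "c \<noteq> unit_vec i"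
  shows "0 \<le> c k - pairing c i * unit_vec i k"
proof -
  have "orthogonal_set {i}" using i by (simp add: orthogonal_set_def)
  then have "\<not> supported_on {i} c"
    using orthogonal_supported_root[OF c, of "{i}"] ne by auto
  then obtain j where j: "j \<noteq> i" "c j \<noteq> 0" by (auto simp: supported_on_def)
  then have "\<not> c j - pairing c i * unit_vec i j \<le> 0"
    using c(2)[of j] by (simp add: unit_vec_apply)
  then show ?thesis using coherent[OF reflection'[OF c(1) i]] by blast
qed

section \<open>Irreducibility and the bound on the eigenvalue\<close>

lemma gram_nonpos:
  assumes "i \<in> I" "j \<in> I" "i \<noteq> j"
  shows "G i j \<le> 0"
proof -
  have "unit_vec i \<noteq> unit_vec j" using assms(3) by (auto simp: unit_vec_apply fun_eq_iff)
  \<comment> \<open>Reflecting the simple root \<open>i\<close> in \<open>j\<close> gives a positive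
    root whose coefficient at \<open>j\<close> is \<open>- G i j\<close>.\<close>
  then have "0 \<le> unit_vec i j - pairing (unit_vec i) j * unit_vec j j"
    using assms reflection_nonneg[OF simple[of i], of j j] by (simp add: unit_vec_apply[of i])
  then show ?thesis
    using assms by (simp add: pairing_unit_vec unit_vec_apply[of _ j])
qed

text \<open>Induction on the sum of coefficients: norm 2 yields an \<open>i\<close> with positive
  pairing, and reflecting in \<open>i\<close> gives a smaller positive root. Its support touches
  \<open>i\<close> or a neighbour of \<open>i\<close>, so undoing the reflection stays in the same
  component.\<close>

lemma root_in_component:
  assumes J: "J \<subseteq> I" "\<And>i j. i \<in> J \<Longrightarrow> j \<in> I - J \<Longrightarrow> G i j = 0"
  shows "c \<in> R \<Longrightarrow> (\<And>i. 0 \<le> c i) \<Longrightarrow> supported_on J c \<or> supported_on (I - J) c"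
proof (induction "nat (\<Sum>i\<in>I. c i)" arbitrary: c rule: less_induct)
  case less
  note c = less.prems
  have "\<exists>i\<in>I. 0 < pairing c i * c i"
  proof (rule ccontr)
    assume "\<not> ?thesis"
    then have "(\<Sum>i\<in>I. pairing c i * c i) \<le> 0" by (intro sum_nonpos) (auto simp: not_less)
    then show False using norm'[OF c(1)] by simp
  qed
  then obtain i where i: "i \<in> I" "0 < pairing c i * c i" by auto
  then have p: "0 < pairing c i" using c(2)[of i] by (simp add: zero_less_mult_iff)
  show ?case
  proof (cases "c = unit_vec i")
    case True
    then show ?thesis using i by (auto simp: supported_on_def unit_vec_apply)
  next
    case False
    define d where "d = (\<lambda>k. c k - pairing c i * unit_vec i k)"
    have dR: "d \<in> R" unfolding d_def using c(1) i(1) by (rule reflection')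
    have d0: "0 \<le> d k" for k
      unfolding d_def using c i(1) False by (intro reflection_nonneg) auto
    have "(\<Sum>k\<in>I. unit_vec i k) = 1"
      using i finite_index by (simp add: unit_vec_apply)
    then have "(\<Sum>k\<in>I. d k) = (\<Sum>k\<in>I. c k) - pairing c i"
      unfolding d_def sum_subtractf sum_distrib_left[symmetric] by simp
    moreover have "0 \<le> (\<Sum>k\<in>I. d k)" using d0 by (simp add: sum_nonneg)
    ultimately have "nat (\<Sum>k\<in>I. d k) < nat (\<Sum>k\<in>I. c k)" using p by linarith
    then have IH: "supported_on J d \<or> supported_on (I - J) d"
      by (rule less.hyps[OF _ dR d0])
    \<comment> \<open>The reflection negates the pairing with \<open>i\<close>, so the pairing of
      \<open>d\<close> with \<open>i\<close> is nonzero and some index in the support of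
      \<open>d\<close> is \<open>i\<close> or is joined to it.\<close>
    have "pairing d i = pairing c i - pairing c i * pairing (unit_vec i) i"
      unfolding d_def pairing_def[of "\<lambda>k. _ k - _ k"] pairing_def[of "unit_vec i"]
      by (simp add: left_diff_distrib sum_subtractf sum_distrib_left mult.assoc pairing_def[of c])
    then have "pairing d i \<noteq> 0" using i p by (simp add: pairing_unit_vec gram_diag)
    then obtain k where k: "k \<in> I" "d k * G k i \<noteq> 0"
      unfolding pairing_def by (rule sum.not_neutral_contains_not_neutral)
    then have k: "k \<in> I" "d k \<noteq> 0" "G k i \<noteq> 0" by auto
    have "k \<in> J \<longleftrightarrow> i \<in> J"
      using J(2)[of k i] J(2)[of i k, unfolded gram_sym[of i k]] k i(1) by blast
    then have "supported_on J d \<Longrightarrow> i \<in> J" "supported_on (I - J) d \<Longrightarrow> i \<in> I - J"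
      using k i by (auto simp: supported_on_def)
    moreover have "c k = d k + pairing c i * unit_vec i k" for k by (simp add: d_def)
    ultimately show ?thesis
      using IH by (auto simp: supported_on_def unit_vec_apply)
  qed
qed

lemma highest_pos: "i \<in> I \<Longrightarrow> 1 \<le> \<psi> i"
  using highest[OF simple, of i i] by (simp add: unit_vec_apply)

lemma highest_nonneg: "0 \<le> \<psi> i"
  using highest_pos[of i] supported[OF highest_root]
  by (cases "i \<in> I") (auto simp: supported_on_def)

text \<open>The highest root dominates every simple root and so has full support. It would lie in
  one component if the diagram were disconnected.\<close>

lemma irreducible:
  assumes "J \<subset> I" "J \<noteq> {}"
  shows "\<exists>i\<in>J. \<exists>j\<in>I - J. G i j \<noteq> 0"
proof (rule ccontr)
  assume *: "\<not> ?thesis"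
  have "supported_on J \<psi> \<or> supported_on (I - J) \<psi>"
    using assms * by (intro root_in_component highest_root highest_nonneg) auto
  moreover obtain i j where "i \<in> J" "j \<in> I - J" using assms by auto
  ultimately show False
    using highest_pos[of i] highest_pos[of j] assms by (auto simp: supported_on_def)
qed

lemma index_nonempty: "I \<noteq> {}"
  using norm'[OF highest_root] by force

text \<open>The highest root is dominant: reflecting it in \<open>i\<close> cannot raise its
  coefficient at \<open>i\<close>.\<close>

lemma pairing_highest: "i \<in> I \<Longrightarrow> 0 \<le> pairing \<psi> i"
  using highest[OF reflection'[OF highest_root], of i i] by (simp add: unit_vec_apply)

text \<open>The eigenvector comes from Perron-Frobenius. For the bound, pair it with the highest
  root: \<open>2 - \<mu>\<close> times that pairing is the sum of
  \<open>x i * pairing \<psi> i\<close>, whose terms are nonnegative and, as \<psi> has norm 2, not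
  all zero.\<close>

lemma adj_eigenvector:
  obtains x \<mu> where "\<And>i. i \<in> I \<Longrightarrow> (0::real) < x i" and "\<mu> < 2"
    and "\<And>c. (\<Sum>i\<in>I. x i * of_int (adj c i)) = \<mu> * (\<Sum>i\<in>I. x i * of_int (c i))"
proof -
  define A where "A i j = (if i = j then 0 else - real_of_int (G i j))" for i j
  have irr: "\<exists>i\<in>J. \<exists>j\<in>I - J. A i j \<noteq> 0" if J: "J \<subset> I" "J \<noteq> {}" for J
  proof -
    obtain i j where "i \<in> J" "j \<in> I - J" "G i j \<noteq> 0" using irreducible[OF J] by auto
    then show ?thesis by (intro bexI[of _ i] bexI[of _ j]) (auto simp: A_def)
  qed
  have sym: "A i j = A j i" for i j by (simp add: A_def gram_sym[of i])
  have nonneg: "0 \<le> A i j" if "i \<in> I" "j \<in> I" for i j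
    using that gram_nonpos[of i j] by (simp add: A_def)
  obtain x \<mu> where x: "\<And>i. i \<in> I \<Longrightarrow> 0 < x i"
    and eigen: "\<And>i. i \<in> I \<Longrightarrow> (\<Sum>j\<in>I. A i j * x j) = \<mu> * x i"
    by (rule perron_frobenius_symmetric[OF finite_index index_nonempty sym nonneg irr]) blast+
  have adj: "real_of_int (adj c i) = (\<Sum>k\<in>I. A k i * of_int (c k))" if "i \<in> I" for c i
  proof -
    have "(\<Sum>k\<in>I. A k i * of_int (c k))
        = (\<Sum>k\<in>I. (if k = i then 2 * of_int (c k) else 0) - of_int (c k * G k i))"
      using gram_diag by (intro sum.cong) (auto simp: A_def)
    then show ?thesis
      using that finite_index by (simp add: adj_def pairing_def sum_subtractf)
  qed
  have f_adj: "(\<Sum>i\<in>I. x i * of_int (adj c i)) = \<mu> * (\<Sum>i\<in>I. x i * of_int (c i))" for c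
  proof -
    have "(\<Sum>i\<in>I. x i * of_int (adj c i)) = (\<Sum>i\<in>I. \<Sum>k\<in>I. of_int (c k) * (A k i * x i))"
      by (intro sum.cong refl) (simp add: adj sum_distrib_left mult_ac)
    also have "\<dots> = (\<Sum>k\<in>I. of_int (c k) * (\<Sum>i\<in>I. A k i * x i))"
      by (subst sum.swap) (simp add: sum_distrib_left)
    also have "\<dots> = \<mu> * (\<Sum>k\<in>I. x k * of_int (c k))"
      unfolding sum_distrib_left[of \<mu>] by (intro sum.cong refl) (simp add: eigen)
    finally show ?thesis .
  qed
  have "(\<Sum>i\<in>I. pairing \<psi> i * \<psi> i) \<noteq> 0"
    using norm'[OF highest_root] by simp
  then obtain i where "i \<in> I" "pairing \<psi> i * \<psi> i \<noteq> 0"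
    by (rule sum.not_neutral_contains_not_neutral)
  then have i: "i \<in> I" "0 < pairing \<psi> i"
    using pairing_highest[of i] by (auto simp: less_le)
  have "0 < (\<Sum>i\<in>I. x i * of_int (pairing \<psi> i))"
    using finite_index i x pairing_highest
    by (intro sum_pos2[of _ i]) (auto simp: less_imp_le)
  also have "(\<Sum>i\<in>I. x i * of_int (pairing \<psi> i))
      = (\<Sum>i\<in>I. 2 * (x i * of_int (\<psi> i)) - x i * of_int (adj \<psi> i))"
    by (intro sum.cong) (auto simp: adj_def algebra_simps)
  also have "\<dots> = (2 - \<mu>) * (\<Sum>i\<in>I. x i * of_int (\<psi> i))"
    unfolding sum_subtractf f_adj sum_distrib_left[of 2, symmetric] by (rule left_diff_distrib[symmetric])
  finally have "0 < (2 - \<mu>) * (\<Sum>i\<in>I. x i * of_int (\<psi> i))" .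
  moreover have "0 \<le> (\<Sum>i\<in>I. x i * of_int (\<psi> i))"
    using x highest_nonneg by (intro sum_nonneg mult_nonneg_nonneg) (auto simp: less_imp_le)
  ultimately have "\<mu> < 2" by (simp add: zero_less_mult_iff)
  with x f_adj show ?thesis using that by blast
qed

end


section \<open>Alternating reflections\<close>

context bipartite_roots
begin

text \<open>Each term plus the term two steps later is the neighbour sum of the term between them:
  the mesh relation of Auslander-Reiten theory. \<open>v\<close> and \<open>w\<close> are two
  arbitrary consecutive terms.\<close>

fun mesh :: "(nat \<Rightarrow> int) \<Rightarrow> (nat \<Rightarrow> int) \<Rightarrow> nat \<Rightarrow> nat \<Rightarrow> int" where
  "mesh v w 0 = v"
| "mesh v w (Suc 0) = w"
| "mesh v w (Suc (Suc t)) = (\<lambda>i. adj (mesh v w (Suc t)) i - mesh v w t i)"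

lemma adj_zero: "adj (\<lambda>_. 0) = (\<lambda>_. 0)"
  by (auto simp: adj_def pairing_def)

lemma adj_uminus: "adj (\<lambda>i. - c i) = (\<lambda>i. - adj c i)"
  by (auto simp: adj_def pairing_uminus)

lemma mesh_add: "mesh v w (n + t) = mesh (mesh v w n) (mesh v w (Suc n)) t"
  by (induction v w t rule: mesh.induct) auto

lemma mesh_uminus: "mesh (\<lambda>i. - v i) (\<lambda>i. - w i) t = (\<lambda>i. - mesh v w t i)"
  by (induction v w t rule: mesh.induct) (auto simp: adj_uminus)

text \<open>The recurrence is symmetric in its two outer terms, so a sequence read backwards
  satisfies it too.\<close>

lemma mesh_reverse:
  "t \<le> Suc n \<Longrightarrow> mesh (mesh v w (Suc n)) (mesh v w n) t = mesh v w (Suc n - t)"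
proof (induction t rule: less_induct)
  case (less t)
  show ?case
  proof (cases "t < 2")
    case True
    then have "t = 0 \<or> t = 1" by auto
    then show ?thesis by auto
  next
    case False
    then obtain s where t: "t = Suc (Suc s)" by (metis add_2_eq_Suc le_add_diff_inverse not_less)
    then obtain m where n: "n = Suc s + m" using less.prems le_Suc_ex[of "Suc s" n] by auto
    have "mesh (mesh v w (Suc n)) (mesh v w n) (Suc s) = mesh v w (Suc m)"
      using less.IH[of "Suc s"] t n by simp
    moreover have "mesh (mesh v w (Suc n)) (mesh v w n) s = mesh v w (Suc (Suc m))"
      using less.IH[of s] t n by simp
    ultimately show ?thesis using t n by (simp del: mesh.simps add: mesh.simps(3))
  qed
qed

definition adjacent_state :: "(nat \<Rightarrow> int) \<Rightarrow> (nat \<Rightarrow> int) \<Rightarrow> bool" where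
  "adjacent_state v w \<longleftrightarrow> (\<lambda>i. v i + w i) \<in> R \<and>
     (supported_on I1 v \<and> supported_on I2 w \<or> supported_on I2 v \<and> supported_on I1 w)"

text \<open>By orthogonality, changing the coefficients in \<open>S\<close> does not affect the
  pairing with \<open>i\<close>; reflecting one index at a time gives the simultaneous
  reflection.\<close>

lemma refl_set_insert:
  assumes "i \<notin> S" "orthogonal_set (insert i S)"
  shows "refl_set (insert i S) c = (\<lambda>j. refl_set S c j - pairing (refl_set S c) i * unit_vec i j)"
proof -
  have o: "\<And>k. k \<in> S \<Longrightarrow> k \<in> I \<and> G k i = 0"
    using assms by (auto simp: orthogonal_set_def)
  have "pairing (refl_set S c) i = pairing c i"
    unfolding pairing_def using o by (intro sum.cong) (auto simp: refl_set_def)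
  then show ?thesis
    using assms(1) by (auto simp: refl_set_def unit_vec_apply)
qed

lemma refl_set_root:
  assumes "finite S" "orthogonal_set S" "c \<in> R"
  shows "refl_set S c \<in> R"
  using assms
proof (induction S rule: finite_induct)
  case empty
  then show ?case by (simp add: refl_set_def)
next
  case (insert i S)
  have "i \<in> I" "orthogonal_set S"
    using insert.prems(1) by (auto simp: orthogonal_set_def)
  then show ?case
    using reflection'[OF insert.IH] insert by (simp add: refl_set_insert)
qed

text \<open>On \<open>S\<close> the part \<open>v\<close> pairs to \<open>2 * v\<close> and is
  negated, while \<open>w\<close>, living on \<open>S'\<close>, contributes \<open>adj w\<close>. On
  \<open>S'\<close> the vector \<open>adj w\<close> vanishes by orthogonality. So reflecting in one
  colour replaces \<open>v\<close> by the next term of the recurrence.\<close>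

lemma refl_set_step:
  assumes "supported_on S v" "supported_on S' w" "S \<union> S' = I" "S \<inter> S' = {}"
    "orthogonal_set S" "orthogonal_set S'"
  shows "refl_set S (\<lambda>i. v i + w i) = (\<lambda>i. w i + (adj w i - v i))"
    and "supported_on S (\<lambda>i. adj w i - v i)"
proof -
  have v: "pairing v i = 2 * v i" "w i = 0" if "i \<in> S" for i
    using assms that pairing_orthogonal[of S v i] by (auto simp: supported_on_def)
  have w: "pairing w i = 2 * w i" "v i = 0" if "i \<in> S'" for i
    using assms that pairing_orthogonal[of S' w i] by (auto simp: supported_on_def)
  have out: "v i = 0 \<and> w i = 0" if "i \<notin> I" for i
    using assms that by (auto simp: supported_on_def)
  have adj: "adj w i = (if i \<in> S then - pairing w i else 0)" for i
    using assms(3) v w by (auto simp: adj_def)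
  show "refl_set S (\<lambda>i. v i + w i) = (\<lambda>i. w i + (adj w i - v i))"
  proof
    fix i
    show "refl_set S (\<lambda>i. v i + w i) i = w i + (adj w i - v i)"
      using v[of i] w[of i] out[of i] assms(3) unfolding adj refl_set_def pairing_add
      by (cases "i \<in> S"; cases "i \<in> S'") auto
  qed
  show "supported_on S (\<lambda>i. adj w i - v i)"
    using assms(1) by (auto simp: adj supported_on_def)
qed

lemma finite_I1: "finite I1" and finite_I2: "finite I2"
  using finite_index by auto

lemma adjacent_state_step:
  assumes "adjacent_state v w"
  shows "adjacent_state w (\<lambda>i. adj w i - v i)"
proof -
  have *: "(\<lambda>i. w i + (adj w i - v i)) \<in> R \<and> supported_on S (\<lambda>i. adj w i - v i)"
    if "supported_on S v" "supported_on S' w" "S \<union> S' = I" "S \<inter> S' = {}"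
      "orthogonal_set S" "orthogonal_set S'" "finite S" for S S'
    using refl_set_step[OF that(1-6)] refl_set_root[OF that(7,5)] assms
    by (metis adjacent_state_def)
  show ?thesis
    using assms *[of I1 I2] *[of I2 I1] disjoint orthogonal_I1 orthogonal_I2 finite_I1 finite_I2
    unfolding adjacent_state_def by (metis Int_commute Un_commute)
qed

lemma adjacent_state_mesh:
  "adjacent_state v w \<Longrightarrow> adjacent_state (mesh v w t) (mesh v w (Suc t))"
  by (induction t) (auto dest: adjacent_state_step)

lemma adjacent_state_coherent:
  assumes "adjacent_state v w"
  shows "(\<forall>i. 0 \<le> v i \<and> 0 \<le> w i) \<or> (\<forall>i. v i \<le> 0 \<and> w i \<le> 0)"
proof -
  have "v i = 0 \<or> w i = 0" for i
    using assms disjoint by (auto simp: adjacent_state_def supported_on_def)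
  moreover have "(\<forall>i. 0 \<le> v i + w i) \<or> (\<forall>i. v i + w i \<le> 0)"
    using assms coherent[of "\<lambda>i. v i + w i"] by (auto simp: adjacent_state_def)
  ultimately show ?thesis by (metis add_0 add_0_right order_refl)
qed

lemma adjacent_state_supported:
  "adjacent_state v w \<Longrightarrow> supported_on I v \<and> supported_on I w"
  by (auto simp: adjacent_state_def supported_on_def)

lemma zero_not_root: "(\<lambda>_. 0) \<notin> R"
  using norm by force

lemma adjacent_state_zero_right:
  assumes "adjacent_state v (\<lambda>_. 0)" "\<And>i. 0 \<le> v i"
  shows "\<exists>j\<in>I. v = unit_vec j"
proof -
  have "v \<in> R" "supported_on I1 v \<or> supported_on I2 v"
    using assms(1) by (auto simp: adjacent_state_def)
  then show ?thesis
    using orthogonal_supported_root[of v] assms(2) orthogonal_I1 orthogonal_I2 by blast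
qed

lemma adjacent_state_unit_vec: "j \<in> I \<Longrightarrow> adjacent_state (\<lambda>_. 0) (unit_vec j)"
  using simple[of j] supported_on_unit_vec[of j]
  by (auto simp: adjacent_state_def supported_on_def[of _ "\<lambda>_. 0"])

end

section \<open>First zeros and periods of the alternating sequences\<close>

locale bipartite_roots_eigenvector = bipartite_roots +
  fixes x :: "nat \<Rightarrow> real" and \<mu> :: real
  assumes x_pos: "\<And>i. i \<in> I \<Longrightarrow> 0 < x i" and \<mu>_less: "\<mu> < 2"
    and x_adj: "\<And>c. (\<Sum>i\<in>I. x i * of_int (adj c i)) = \<mu> * (\<Sum>i\<in>I. x i * of_int (c i))"
begin

text \<open>Weighted by the eigenvector rather than the sum of the coefficients, so that
  \<open>adj\<close> acts on heights as multiplication by \<mu>.\<close>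

definition height where "height c = (\<Sum>i\<in>I. x i * of_int (c i))"

text \<open>The Chebyshev polynomials of the second kind at \<mu>/2, shifted by one. Up to the
  factor \<open>x j\<close> this is the height sequence of every simple root, whence a common first
  zero \<open>T\<close>.\<close>

fun u :: "nat \<Rightarrow> real" where
  "u 0 = 0"
| "u (Suc 0) = 1"
| "u (Suc (Suc t)) = \<mu> * u (Suc t) - u t"

definition T :: nat where "T = (LEAST t. 0 < t \<and> u t = 0)"

abbreviation simple_mesh :: "nat \<Rightarrow> nat \<Rightarrow> nat \<Rightarrow> int" where
  "simple_mesh j \<equiv> mesh (\<lambda>_. 0) (unit_vec j)"

lemma height_mesh:
  "height (mesh v w (Suc (Suc t))) = \<mu> * height (mesh v w (Suc t)) - height (mesh v w t)"
  using x_adj by (simp add: height_def right_diff_distrib sum_subtractf)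

lemma height_nonneg: "(\<And>i. 0 \<le> c i) \<Longrightarrow> 0 \<le> height c"
  unfolding height_def using x_pos by (intro sum_nonneg mult_nonneg_nonneg) (auto simp: less_imp_le)

lemma height_eq_0:
  assumes "\<And>i. 0 \<le> c i" "supported_on I c" "height c = 0"
  shows "c = (\<lambda>_. 0)"
proof
  fix i
  have "\<forall>i\<in>I. x i * of_int (c i) = 0"
    using assms(1,3) x_pos finite_index unfolding height_def
    by (subst (asm) sum_nonneg_eq_0_iff) (auto intro!: mult_nonneg_nonneg simp: less_imp_le)
  then have "x i * of_int (c i) = 0" if "i \<in> I" using that by blast
  then show "c i = 0"
    using assms(2) x_pos[of i] by (cases "i \<in> I") (simp_all add: supported_on_def)
qed

lemma height_unit_vec: "j \<in> I \<Longrightarrow> height (unit_vec j) = x j"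
proof -
  assume "j \<in> I"
  have "height (unit_vec j) = (\<Sum>i\<in>I. if i = j then x i else 0)"
    unfolding height_def unit_vec_apply by (intro sum.cong) auto
  then show ?thesis using \<open>j \<in> I\<close> finite_index by simp
qed

lemma height_simple_mesh: "j \<in> I \<Longrightarrow> height (simple_mesh j t) = x j * u t"
proof (induction t rule: u.induct)
  case (3 t)
  then show ?case by (simp only: height_mesh u.simps) (simp add: algebra_simps)
qed (simp_all add: height_unit_vec, simp add: height_def)

text \<open>The heights satisfy the scalar recurrence with \<mu> < 2, so the terms cannot stay
  nonnegative forever. The term just before the first negative one is nonnegative by minimality and
  nonpositive by coherence with its successor, hence 0; the one before it is then a root of a single
  colour, that is, simple.\<close>

lemma sign_change:
  assumes vw: "adjacent_state v w" and nonneg: "\<And>i. 0 \<le> v i" "\<And>i. 0 \<le> w i"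
  shows "\<exists>m. \<exists>j\<in>I. mesh v w (Suc m) = (\<lambda>_. 0) \<and> mesh v w m = unit_vec j \<and>
    (\<forall>t\<le>Suc m. \<forall>i. 0 \<le> mesh v w t i)"
proof -
  have "\<exists>t. \<not> (\<forall>i. 0 \<le> mesh v w t i)"
  proof (rule ccontr)
    assume "\<not> ?thesis"
    then have "height (mesh v w 0) = 0 \<and> height (mesh v w 1) = 0"
      by (intro recurrence_nonneg_imp_zero[OF \<mu>_less] height_mesh height_nonneg) auto
    then have "v = (\<lambda>_. 0)" "w = (\<lambda>_. 0)"
      using height_eq_0 nonneg adjacent_state_supported[OF vw] by auto
    then show False using vw zero_not_root by (simp add: adjacent_state_def)
  qed
  then obtain t where t: "\<not> (\<forall>i. 0 \<le> mesh v w t i)"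
    and least: "\<And>s. s < t \<Longrightarrow> \<forall>i. 0 \<le> mesh v w s i"
    using exists_least_iff[of "\<lambda>t. \<not> (\<forall>i. 0 \<le> mesh v w t i)"] by blast
  have "t \<noteq> 0" "t \<noteq> Suc 0"
    using t nonneg by (metis mesh.simps(1), metis mesh.simps(2))
  then obtain m where m: "t = Suc (Suc m)" by (metis not0_implies_Suc)
  have "\<forall>i. mesh v w (Suc m) i \<le> 0"
    using adjacent_state_coherent[OF adjacent_state_mesh[OF vw, of "Suc m"]] t m by blast
  then have zero: "mesh v w (Suc m) = (\<lambda>_. 0)"
    using least[of "Suc m"] m by (auto intro: antisym)
  moreover have "\<exists>j\<in>I. mesh v w m = unit_vec j"
    using adjacent_state_mesh[OF vw, of m] least[of m] m zero
    by (intro adjacent_state_zero_right) auto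
  ultimately show ?thesis using least m by (metis less_Suc_eq_le)
qed

lemma u_consecutive: "u t \<noteq> 0 \<or> u (Suc t) \<noteq> 0"
  by (induction t) auto

text \<open>The zero found by \<open>sign_change\<close> is a zero of \<open>u\<close>, and up to it
  \<open>u\<close> is nonnegative. So it is the first positive zero of \<open>u\<close>, whatever
  \<open>j\<close> is.\<close>

lemma simple_mesh_T:
  assumes j: "j \<in> I"
  shows "0 < T" and "simple_mesh j T = (\<lambda>_. 0)"
    and "\<exists>k\<in>I. simple_mesh j (T - 1) = unit_vec k"
    and "\<And>t. 0 < t \<Longrightarrow> t < T \<Longrightarrow> simple_mesh j t \<noteq> (\<lambda>_. 0)"
    and "\<And>t i. t \<le> T \<Longrightarrow> 0 \<le> simple_mesh j t i"
proof -
  have pos: "0 \<le> unit_vec j i" for i by (simp add: unit_vec_apply)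
  obtain m k where k: "k \<in> I" and zero: "simple_mesh j (Suc m) = (\<lambda>_. 0)"
    and unit: "simple_mesh j m = unit_vec k"
    and nonneg: "\<And>t i. t \<le> Suc m \<Longrightarrow> 0 \<le> simple_mesh j t i"
    using sign_change[OF adjacent_state_unit_vec[OF j] order_refl pos] by blast
  have u_nonneg: "0 \<le> u t" if "t \<le> Suc m" for t
    using height_nonneg[of "simple_mesh j t"] nonneg[OF that] height_simple_mesh[OF j, of t] x_pos[OF j]
    by (auto simp: zero_le_mult_iff)
  have u_zero: "u (Suc m) = 0"
    using height_simple_mesh[OF j, of "Suc m"] zero x_pos[OF j] by (simp add: height_def)
  \<comment> \<open>At an earlier zero the neighbouring values of \<open>u\<close> would be opposite
    and both nonnegative, producing two consecutive zeros.\<close>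
  have u_nonzero: "u t \<noteq> 0" if t: "0 < t" "t < Suc m" for t
  proof
    assume "u t = 0"
    obtain s where s: "t = Suc s" using t by (cases t) auto
    then have "u (Suc t) = - u s" using \<open>u t = 0\<close> by simp
    moreover have "0 \<le> u s" "0 \<le> u (Suc t)" using s t by (auto intro!: u_nonneg simp del: u.simps)
    ultimately have "u s = 0" by linarith
    then show False using u_consecutive[of s] s \<open>u t = 0\<close> by simp
  qed
  have T: "T = Suc m"
    unfolding T_def
  proof (rule Least_equality)
    show "Suc m \<le> t" if "0 < t \<and> u t = 0" for t
      using that u_nonzero[of t] by (meson not_less)
  qed (simp add: u_zero)
  show "0 < T" "simple_mesh j T = (\<lambda>_. 0)" "\<exists>k\<in>I. simple_mesh j (T - 1) = unit_vec k"
    using T zero unit k by auto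
  show "0 \<le> simple_mesh j t i" if "t \<le> T" for t i
    using nonneg that T by simp
  show "simple_mesh j t \<noteq> (\<lambda>_. 0)" if "0 < t" "t < T" for t
  proof
    assume "simple_mesh j t = (\<lambda>_. 0)"
    then have "u t = 0"
      using height_simple_mesh[OF j, of t] x_pos[OF j] by (simp add: height_def)
    then show False using u_nonzero that T by simp
  qed
qed

lemma unit_vec_inj: "unit_vec i = unit_vec j \<longleftrightarrow> i = j"
  by (auto simp: unit_vec_def fun_eq_iff split: if_splits)

text \<open>After the zero at \<open>T\<close> the next term is minus the simple root at
  \<open>T - 1\<close>, so the sequence restarts as the negative of another simple sequence.
  Reversing the stretch up to \<open>T\<close> shows that \<open>j\<close> and \<open>k\<close>
  exchange roles.\<close>

lemma simple_mesh_add_T: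
  assumes j: "j \<in> I"
  obtains k where "k \<in> I" "\<And>t. simple_mesh j (T + t) = (\<lambda>i. - simple_mesh k t i)"
    and "\<And>t. simple_mesh k (T + t) = (\<lambda>i. - simple_mesh j t i)"
proof -
  have *: "simple_mesh i (T + t) = (\<lambda>l. - simple_mesh k t l)"
    if "i \<in> I" "simple_mesh i (T - 1) = unit_vec k" for i k t
  proof -
    have "0 < T" using that(1) by (rule simple_mesh_T)
    then obtain n where n: "T = Suc n" by (cases T) auto
    have "simple_mesh i (Suc T) = (\<lambda>l. adj (simple_mesh i T) l - simple_mesh i n l)"
      unfolding n by (rule mesh.simps(3))
    then have "simple_mesh i (Suc T) = (\<lambda>l. - unit_vec k l)"
      using simple_mesh_T(2)[OF that(1)] that(2) n by (simp add: adj_zero)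
    then show ?thesis
      using mesh_add[of "\<lambda>_. 0" "unit_vec i" T t] simple_mesh_T(2)[OF that(1)]
        mesh_uminus[of "\<lambda>_. 0" "unit_vec k" t] by simp
  qed
  obtain k where k: "k \<in> I" "simple_mesh j (T - 1) = unit_vec k"
    using simple_mesh_T(3)[OF j] by auto
  obtain n where n: "T = Suc n" using simple_mesh_T(1)[OF j] by (cases T) auto
  \<comment> \<open>Read backwards from the zero at \<open>T\<close>, the sequence of
    \<open>j\<close> is that of \<open>k\<close>; it arrives at the simple root \<open>j\<close>
    after \<open>T - 1\<close> steps.\<close>
  have "simple_mesh k n = simple_mesh j (Suc n - n)"
    using mesh_reverse[of n n "\<lambda>_. 0" "unit_vec j"] simple_mesh_T(2)[OF j] k n by simp
  then have k': "simple_mesh k (T - 1) = unit_vec j" using n by simp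
  show ?thesis using that[OF k(1) *[OF j k(2)] *[OF k(1) k']] .
qed

lemma simple_mesh_period:
  assumes "j \<in> I"
  shows "simple_mesh j (2 * T + t) = simple_mesh j t"
proof -
  obtain k where "\<And>t. simple_mesh j (T + t) = (\<lambda>i. - simple_mesh k t i)"
    "\<And>t. simple_mesh k (T + t) = (\<lambda>i. - simple_mesh j t i)"
    by (rule simple_mesh_add_T[OF assms]) iprover
  then have "simple_mesh j (T + (T + t)) = simple_mesh j t" by simp
  then show ?thesis by (simp add: mult_2 add.assoc)
qed

lemma simple_mesh_mult_period:
  assumes "j \<in> I"
  shows "simple_mesh j (q * (2 * T) + t) = simple_mesh j t"
proof (induction q)
  case (Suc q)
  then show ?case using simple_mesh_period[OF assms, of "q * (2 * T) + t"] by (simp add: add.assoc)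
qed simp

text \<open>Zeros occur only at multiples of \<open>T\<close>. After an odd multiple a negative
  simple root follows, so a positive one follows only at multiples of \<open>2 * T\<close>, and
  there the sequence repeats from \<open>j\<close>.\<close>

lemma simple_mesh_return:
  assumes j: "j \<in> I" and zero: "simple_mesh j t = (\<lambda>_. 0)" and unit: "simple_mesh j (Suc t) = unit_vec i"
  shows "i = j \<and> 2 * T dvd t"
proof -
  have T: "0 < T" using j by (rule simple_mesh_T)
  define r where "r = t mod (2 * T)"
  have r: "r < 2 * T" using T by (simp add: r_def)
  have t: "t = t div (2 * T) * (2 * T) + r"
    unfolding r_def by (rule div_mult_mod_eq[symmetric])
  then have "simple_mesh j (t div (2 * T) * (2 * T) + r) = (\<lambda>_. 0)"
    "simple_mesh j (t div (2 * T) * (2 * T) + Suc r) = unit_vec i"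
    using zero unit t by (metis, metis add_Suc_right)
  then have zr: "simple_mesh j r = (\<lambda>_. 0)" and ur: "simple_mesh j (Suc r) = unit_vec i"
    unfolding simple_mesh_mult_period[OF j] by simp_all
  have "r = 0"
  proof (rule ccontr)
    assume "r \<noteq> 0"
    then have "T \<le> r" using simple_mesh_T(4)[OF j, of r] zr by force
    then obtain s where s: "r = T + s" using le_Suc_ex by blast
    obtain k where k: "k \<in> I" "\<And>t. simple_mesh j (T + t) = (\<lambda>i. - simple_mesh k t i)"
      by (rule simple_mesh_add_T[OF j]) iprover
    have "simple_mesh k s = (\<lambda>_. 0)"
      using zr k(2)[of s] s by (simp add: fun_eq_iff)
    then have "s = 0" using simple_mesh_T(4)[OF k(1), of s] s r by force
    then have "(\<lambda>l. - unit_vec k l) = unit_vec i" using ur k(2)[of 1] s by simp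
    then have "- unit_vec k i = unit_vec i i" by (rule fun_cong)
    then show False by (simp add: unit_vec_apply split: if_splits)
  qed
  then have "2 * T dvd t" "unit_vec j = unit_vec i"
    using ur by (auto simp: r_def mod_eq_0_iff_dvd)
  then show ?thesis by (simp add: unit_vec_inj)
qed

text \<open>Everything is read off from the first zero, at position \<open>Suc n\<close>: the
  sequence continues from there as the negative of the simple sequence of \<open>j\<close>, and read
  backwards from there it is that simple sequence itself.\<close>

theorem positive_root_mesh:
  assumes vw: "adjacent_state v w" and nonneg: "\<And>i. 0 \<le> v i" "\<And>i. 0 \<le> w i"
  obtains n j where "n < T" "j \<in> I" "mesh v w n = unit_vec j" "mesh v w (Suc n) = (\<lambda>_. 0)"
    and "\<And>t. mesh v w (2 * T + t) = mesh v w t"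
    and "\<And>m i. mesh v w m = (\<lambda>_. 0) \<Longrightarrow> mesh v w (Suc m) = (\<lambda>l. - unit_vec i l) \<Longrightarrow>
      i = j \<and> 2 * T dvd m + 2 * T - Suc n"
proof -
  obtain n j where j: "j \<in> I" and zero: "mesh v w (Suc n) = (\<lambda>_. 0)"
    and unit: "mesh v w n = unit_vec j" and pos: "\<And>t i. t \<le> Suc n \<Longrightarrow> 0 \<le> mesh v w t i"
    using sign_change[OF assms] by blast
  have next_unit: "mesh v w (Suc (Suc n)) = (\<lambda>i. - unit_vec j i)"
    using zero unit by (simp add: adj_zero)
  have after: "mesh v w (Suc n + t) = (\<lambda>i. - simple_mesh j t i)" for t
    unfolding mesh_add next_unit zero using mesh_uminus[of "\<lambda>_. 0" "unit_vec j" t] by simp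
  have before: "mesh v w (Suc n - t) = simple_mesh j t" if "t \<le> Suc n" for t
    using mesh_reverse[OF that, of v w] zero unit by simp
  have T: "0 < T" using j by (rule simple_mesh_T)
  have nT: "n < T"
  proof (rule ccontr)
    assume "\<not> n < T"
    obtain k where k: "k \<in> I" "\<And>t. simple_mesh j (T + t) = (\<lambda>i. - simple_mesh k t i)"
      by (rule simple_mesh_add_T[OF j]) iprover
    \<comment> \<open>If the first zero came later than \<open>T\<close>, going back
      \<open>T + 1\<close> steps from it would reach a negative simple root before the sign
      change.\<close>
    have "mesh v w (Suc n - (T + 1)) = (\<lambda>i. - unit_vec k i)"
      using before[of "T + 1"] k(2)[of 1] \<open>\<not> n < T\<close> by simp
    moreover have "0 \<le> mesh v w (Suc n - (T + 1)) k" by (rule pos) simp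
    ultimately show False by (simp add: unit_vec_apply)
  qed
  have period: "mesh v w (2 * T + t) = mesh v w t" for t
  proof (cases "t \<le> Suc n")
    case True
    \<comment> \<open>\<open>N\<close> and \<open>Suc N\<close> are the positions \<open>n\<close>
      and \<open>Suc n\<close> shifted by one period. The two terms there agree with the unshifted
      ones, so both runs backwards agree.\<close>
    define N where "N = 2 * T + n"
    have "mesh v w (Suc N) = mesh v w (Suc n)"
      using after[of "2 * T"] after[of 0] simple_mesh_period[OF j, of 0] by (simp add: N_def add.commute)
    moreover have "mesh v w N = mesh v w n"
    proof -
      have "mesh v w (Suc (Suc N)) = mesh v w (Suc (Suc n))"
        using after[of "2 * T + 1"] after[of 1] simple_mesh_period[OF j, of 1]
        by (simp add: N_def add.commute del: mesh.simps)
      then show ?thesis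
        using \<open>mesh v w (Suc N) = mesh v w (Suc n)\<close> by (simp add: fun_eq_iff)
    qed
    ultimately have "mesh v w (Suc N - (Suc n - t)) = mesh v w (Suc n - (Suc n - t))"
      using mesh_reverse[of "Suc n - t" N v w] mesh_reverse[of "Suc n - t" n v w]
      by (simp add: N_def)
    then show ?thesis using True by (simp add: N_def)
  next
    case False
    then obtain s where s: "t = Suc n + s" by (metis le_Suc_ex nat_le_linear)
    then show ?thesis
      using after[of "2 * T + s"] after[of s] simple_mesh_period[OF j, of s] by (simp add: add.left_commute)
  qed
  have unique: "i = j \<and> 2 * T dvd m + 2 * T - Suc n"
    if m: "mesh v w m = (\<lambda>_. 0)" "mesh v w (Suc m) = (\<lambda>l. - unit_vec i l)" for m i
  proof -
    \<comment> \<open>The distance from the first zero, shifted by one period because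
      \<open>m\<close> might precede that zero and natural subtraction truncates.\<close>
    define s where "s = m + 2 * T - Suc n"
    have s: "2 * T + m = Suc n + s" using nT by (simp add: s_def)
    have "simple_mesh j s = (\<lambda>_. 0)"
      using m(1) period[of m] after[of s] s by (simp add: fun_eq_iff)
    moreover have "simple_mesh j (Suc s) = unit_vec i"
      using m(2) period[of "Suc m"] after[of "Suc s"] s by (simp add: fun_eq_iff del: mesh.simps)
    ultimately show ?thesis using simple_mesh_return[OF j] by (simp add: s_def)
  qed
  show ?thesis using that[OF nT j unit zero period unique] .
qed

end


section \<open>Orbits of the Coxeter element\<close>

context bipartite_roots
begin

definition coxeter where "coxeter c = refl_set I2 (refl_set I1 c)"

text \<open>The coefficient vector of \<open>beta \<alpha> I1 i\<close>.\<close>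

definition signed_unit :: "nat \<Rightarrow> nat \<Rightarrow> int" where
  "signed_unit i = (if i \<in> I1 then unit_vec i else (\<lambda>j. - unit_vec i j))"

abbreviation root_mesh where
  "root_mesh c \<equiv> mesh (restrict_to I1 c) (restrict_to I2 c)"

text \<open>One application of \<open>coxeter\<close> is two steps of the recurrence: the
  reflections in \<open>I1\<close> replace the even term, those in \<open>I2\<close> the odd
  one.\<close>

lemma coxeter_funpow:
  assumes "supported_on I c"
  shows "(coxeter ^^ m) c = (\<lambda>i. root_mesh c (2 * m) i + root_mesh c (Suc (2 * m)) i) \<and>
    supported_on I1 (root_mesh c (2 * m)) \<and> supported_on I2 (root_mesh c (Suc (2 * m)))"
proof (induction m)
  case 0
  have "c i = restrict_to I1 c i + restrict_to I2 c i" for i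
    using assms disjoint by (auto simp: restrict_to_def supported_on_def)
  then show ?case
    by (auto simp: supported_on_def restrict_to_def)
next
  case (Suc m)
  define v w v' w' where vw: "v = root_mesh c (2 * m)" "w = root_mesh c (Suc (2 * m))"
    and v': "v' = (\<lambda>i. adj w i - v i)" and w': "w' = (\<lambda>i. adj v' i - w i)"
  have mesh: "root_mesh c (2 * Suc m) = v'" "root_mesh c (Suc (2 * Suc m)) = w'"
    by (simp_all add: vw v' w')
  have IH: "(coxeter ^^ m) c = (\<lambda>i. v i + w i)" "supported_on I1 v" "supported_on I2 w"
    using Suc by (simp_all add: vw)
  have step1: "refl_set I1 (\<lambda>i. v i + w i) = (\<lambda>i. w i + v' i)" "supported_on I1 v'"
    unfolding v' using refl_set_step[OF IH(2,3) refl disjoint orthogonal_I1 orthogonal_I2] by simp_all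
  have step2: "refl_set I2 (\<lambda>i. w i + v' i) = (\<lambda>i. v' i + w' i)" "supported_on I2 w'"
    unfolding w' using disjoint
    by (auto intro!: refl_set_step[OF IH(3) step1(2) Un_commute _ orthogonal_I2 orthogonal_I1])
  show ?case
    unfolding mesh funpow.simps(2) comp_apply IH(1) coxeter_def[of "\<lambda>i. v i + w i"] step1(1) step2(1)
    using step1(2) step2(2) by simp
qed

lemma adjacent_state_root:
  assumes "c \<in> R"
  shows "adjacent_state (restrict_to I1 c) (restrict_to I2 c)"
proof -
  have "restrict_to I1 c i + restrict_to I2 c i = c i" for i
    using supported[OF assms] disjoint by (auto simp: restrict_to_def supported_on_def)
  then show ?thesis
    using assms by (simp add: adjacent_state_def supported_on_def) (auto simp: restrict_to_def)
qed

lemma coxeter_root: "c \<in> R \<Longrightarrow> coxeter c \<in> R"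
  unfolding coxeter_def
  by (intro refl_set_root finite_I1 finite_I2 orthogonal_I1 orthogonal_I2)

lemma coxeter_funpow_root: "c \<in> R \<Longrightarrow> (coxeter ^^ m) c \<in> R"
  by (induction m) (auto simp: coxeter_root)

lemma signed_unit_root: "i \<in> I \<Longrightarrow> signed_unit i \<in> R"
  using simple[of i] uminus[OF simple[of i]] by (auto simp: signed_unit_def)

text \<open>The signs in \<open>signed_unit\<close> make both colours a zero followed by a negative
  simple root. For \<open>I1\<close> the even term is the simple root and the zero comes at
  \<open>2 * m + 1\<close>; for \<open>I2\<close> the zero is the even term and the odd term is
  already the negative simple root.\<close>

lemma coxeter_funpow_eq_signed_unit:
  assumes c: "c \<in> R" and i: "i \<in> I" and eq: "(coxeter ^^ m) c = signed_unit i"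
  defines "k \<equiv> 2 * m + (if i \<in> I1 then 1 else 0)"
  shows "root_mesh c k = (\<lambda>_. 0) \<and> root_mesh c (Suc k) = (\<lambda>j. - unit_vec i j)"
proof -
  define v w where vw: "v = root_mesh c (2 * m)" "w = root_mesh c (Suc (2 * m))"
  have sum: "signed_unit i j = v j + w j" and v: "supported_on I1 v" and w: "supported_on I2 w" for j
    using coxeter_funpow[OF supported[OF c], of m] eq by (auto simp: vw)
  have vw0: "v j = 0 \<or> w j = 0" for j
    using v w disjoint by (auto simp: supported_on_def)
  show ?thesis
  proof (cases "i \<in> I1")
    case True
    have "v j = unit_vec i j \<and> w j = 0" for j
      using sum[of j] vw0[of j] w True disjoint
      by (auto simp: signed_unit_def supported_on_def unit_vec_apply split: if_splits)
    then have "v = unit_vec i" "w = (\<lambda>_. 0)" by auto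
    then show ?thesis using True by (simp add: k_def vw adj_zero)
  next
    case False
    then have "i \<in> I2" using i by auto
    then have "v j = 0 \<and> w j = - unit_vec i j" for j
      using sum[of j] vw0[of j] v False
      by (auto simp: signed_unit_def supported_on_def unit_vec_apply split: if_splits)
    then have "v = (\<lambda>_. 0)" "w = (\<lambda>j. - unit_vec i j)" by auto
    then show ?thesis using False by (simp add: k_def vw)
  qed
qed

end

section \<open>Returns of positive roots to the signed simple roots\<close>

context bipartite_roots_eigenvector
begin

text \<open>\<open>T\<close> applications are \<open>2 * T\<close> steps, a full period of the
  sequence of a positive root. Negative roots follow because \<open>coxeter\<close> commutes with
  negation.\<close>

lemma coxeter_funpow_T:
  assumes c: "c \<in> R"
  shows "(coxeter ^^ T) c = c"
proof -
  have pos: "(coxeter ^^ T) d = d" if d: "d \<in> R" "\<And>i. 0 \<le> d i" for d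
  proof -
    have period: "root_mesh d (2 * T + t) = root_mesh d t" for t
      by (rule positive_root_mesh[OF adjacent_state_root[OF d(1)]])
        (auto simp: restrict_to_def d(2))
    have "(coxeter ^^ T) d = (coxeter ^^ 0) d"
      using coxeter_funpow[OF supported[OF d(1)], of T] coxeter_funpow[OF supported[OF d(1)], of 0]
        period[of 0] period[of 1] by simp
    then show ?thesis by simp
  qed
  show ?thesis
  proof (cases "\<forall>i. 0 \<le> c i")
    case True
    then show ?thesis using pos c by blast
  next
    case False
    then have "0 \<le> - c i" for i using coherent[OF c] by auto
    then have "(coxeter ^^ T) (\<lambda>i. - c i) = (\<lambda>i. - c i)"
      by (rule pos[OF uminus[OF c]])
    moreover have "(coxeter ^^ m) (\<lambda>i. - c i) = (\<lambda>i. - (coxeter ^^ m) c i)" for m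
    proof (induction m)
      case (Suc m)
      have "refl_set S (\<lambda>i. - d i) = (\<lambda>i. - refl_set S d i)" for S d
        by (auto simp: refl_set_def pairing_uminus)
      then have "coxeter (\<lambda>i. - d i) = (\<lambda>i. - coxeter d i)" for d
        by (simp add: coxeter_def)
      then show ?case using Suc by simp
    qed simp
    ultimately show ?thesis by (simp add: fun_eq_iff)
  qed
qed

text \<open>The witness \<open>n\<close> is the position of the first zero. It is odd exactly when
  the simple root before it sits at an even position, that is, has colour \<open>I1\<close>. The
  final clause locates every later return modulo \<open>2 * T\<close>.\<close>

lemma positive_root_coxeter:
  assumes c: "c \<in> R" "\<And>i. 0 \<le> c i"
  shows "\<exists>n j. 1 \<le> n \<and> n \<le> T \<and> j \<in> I \<and> (odd n \<longleftrightarrow> j \<in> I1) \<and> (coxeter ^^ (n div 2)) c = signed_unit j \<and>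
    (\<forall>m. \<forall>i\<in>I. (coxeter ^^ m) c = signed_unit i \<longrightarrow>
      i = j \<and> 2 * T dvd 2 * m + (if i \<in> I1 then 1 else 0) + 2 * T - n)"
proof -
  have nonneg: "0 \<le> restrict_to S c i" for S i by (simp add: restrict_to_def c(2))
  obtain n j where n: "n < T" and j: "j \<in> I" and unit: "root_mesh c n = unit_vec j"
    and zero: "root_mesh c (Suc n) = (\<lambda>_. 0)"
    and unique: "\<And>m i. root_mesh c m = (\<lambda>_. 0) \<Longrightarrow> root_mesh c (Suc m) = (\<lambda>l. - unit_vec i l) \<Longrightarrow>
      i = j \<and> 2 * T dvd m + 2 * T - Suc n"
    by (rule positive_root_mesh[OF adjacent_state_root[OF c(1)] nonneg nonneg]) iprover
  note cox = coxeter_funpow[OF supported[OF c(1)]]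
  have nonzero: "unit_vec j j \<noteq> 0" by (simp add: unit_vec_apply)
  have "(odd (Suc n) \<longleftrightarrow> j \<in> I1) \<and> (coxeter ^^ (Suc n div 2)) c = signed_unit j"
  proof (cases "even n")
    case True
    then obtain m where m: "n = 2 * m" by blast
    have "supported_on I1 (unit_vec j)" using cox[of m] unit m by simp
    then have "j \<in> I1" using nonzero unfolding supported_on_def by blast
    then show ?thesis
      using cox[of m] unit zero m by (simp add: signed_unit_def)
  next
    case False
    then obtain m where m: "n = Suc (2 * m)" by (metis oddE Suc_eq_plus1)
    have "supported_on I2 (unit_vec j)" using cox[of m] unit m by simp
    then have "j \<in> I2" using nonzero unfolding supported_on_def by blast
    then have "j \<notin> I1" using disjoint by auto
    \<comment> \<open>For colour \<open>I2\<close> the positive simple root precedes the zero; one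
      step past the zero gives its negative, which is the signed unit.\<close>
    have "root_mesh c (Suc (Suc n)) = (\<lambda>i. - unit_vec j i)"
      using unit zero by (simp add: adj_zero)
    then have "(coxeter ^^ Suc m) c = (\<lambda>i. - unit_vec j i)"
      using cox[of "Suc m"] zero m by (simp del: mesh.simps funpow.simps)
    then show ?thesis
      using \<open>j \<notin> I1\<close> m by (simp add: signed_unit_def)
  qed
  moreover have "i = j \<and> 2 * T dvd 2 * m + (if i \<in> I1 then 1 else 0) + 2 * T - Suc n"
    if "i \<in> I" "(coxeter ^^ m) c = signed_unit i" for m i
    using coxeter_funpow_eq_signed_unit[OF c(1) that] unique by blast
  ultimately show ?thesis
    using n j by (intro exI[of _ "Suc n"] exI[of _ j]) auto
qed

end

text \<open>\<open>N\<close> is the common first zero \<open>T\<close>; the statement no longer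
  mentions the eigenvector that defines it.\<close>

theorem (in bipartite_roots) coxeter_orbits:
  obtains N where "0 < N" and "\<And>c. c \<in> R \<Longrightarrow> (coxeter ^^ N) c = c"
    and "\<And>c. c \<in> R \<Longrightarrow> (\<And>i. 0 \<le> c i) \<Longrightarrow>
      \<exists>n j. 1 \<le> n \<and> n \<le> N \<and> j \<in> I \<and> (odd n \<longleftrightarrow> j \<in> I1) \<and> (coxeter ^^ (n div 2)) c = signed_unit j \<and>
        (\<forall>m. \<forall>i\<in>I. (coxeter ^^ m) c = signed_unit i \<longrightarrow>
          i = j \<and> 2 * N dvd 2 * m + (if i \<in> I1 then 1 else 0) + 2 * N - n)"
proof -
  obtain x \<mu> where x: "\<And>i. i \<in> I \<Longrightarrow> (0::real) < x i" "\<mu> < 2"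
    "\<And>c. (\<Sum>i\<in>I. x i * of_int (adj c i)) = \<mu> * (\<Sum>i\<in>I. x i * of_int (c i))"
    by (rule adj_eigenvector) iprover
  interpret E: bipartite_roots_eigenvector I1 I2 G R \<psi> x \<mu>
    by unfold_locales (use x in auto)
  obtain i where "i \<in> I" using index_nonempty by blast
  then have "0 < E.T" by (rule E.simple_mesh_T)
  then show ?thesis using that E.coxeter_funpow_T E.positive_root_coxeter by blast
qed


section \<open>Transfer to the roots of the Lie algebra\<close>

lemma std_form_unit_vec:
  assumes "i \<in> {1..dynkin_rank X}" "j \<in> {1..dynkin_rank X}"
  shows "std_form X (unit_vec i) (unit_vec j) = cartan_matrix X i j"
proof -
  have "unit_vec i k * cartan_matrix X k m * unit_vec j m
      = (if m = j then if k = i then cartan_matrix X i j else 0 else 0)" for k m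
    by (simp add: unit_vec_apply)
  then show ?thesis using assms by (simp add: std_form_def)
qed

lemma std_form_sym: "std_form X c d = std_form X d c"
proof -
  have "cartan_matrix X i j = cartan_matrix X j i" for i j
    by (auto simp: cartan_matrix_def)
  then have "std_form X c d = (\<Sum>i\<in>{1..dynkin_rank X}. \<Sum>j\<in>{1..dynkin_rank X}. d j * cartan_matrix X j i * c i)"
    unfolding std_form_def by (intro sum.cong refl) (simp add: mult_ac)
  also have "\<dots> = std_form X d c"
    unfolding std_form_def by (rule sum.swap)
  finally show ?thesis .
qed

lemma std_form_diff_left: "std_form X (\<lambda>j. c j - k * e j) d = std_form X c d - k * std_form X e d"
  by (simp add: std_form_def left_diff_distrib sum_subtractf sum_distrib_left mult.assoc)

lemma std_form_diff_right: "std_form X d (\<lambda>j. c j - k * e j) = std_form X d c - k * std_form X d e"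
  unfolding std_form_sym[of X d] by (rule std_form_diff_left)

lemma std_form_sum_left:
  "std_form X (\<lambda>k. \<Sum>i\<in>S. c i * p i k) d = (\<Sum>i\<in>S. c i * std_form X (p i) d)"
proof -
  have "std_form X (\<lambda>k. \<Sum>i\<in>S. c i * p i k) d
      = (\<Sum>k\<in>{1..dynkin_rank X}. \<Sum>j\<in>{1..dynkin_rank X}. \<Sum>i\<in>S. c i * (p i k * cartan_matrix X k j * d j))"
    unfolding std_form_def by (simp add: sum_distrib_right mult.assoc)
  also have "\<dots> = (\<Sum>k\<in>{1..dynkin_rank X}. \<Sum>i\<in>S. \<Sum>j\<in>{1..dynkin_rank X}. c i * (p i k * cartan_matrix X k j * d j))"
    by (intro sum.cong refl sum.swap)
  also have "\<dots> = (\<Sum>i\<in>S. \<Sum>k\<in>{1..dynkin_rank X}. \<Sum>j\<in>{1..dynkin_rank X}. c i * (p i k * cartan_matrix X k j * d j))"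
    by (rule sum.swap)
  also have "\<dots> = (\<Sum>i\<in>S. c i * std_form X (p i) d)"
    by (simp add: std_form_def sum_distrib_left)
  finally show ?thesis .
qed

lemma std_form_root: "c \<in> std_roots X \<Longrightarrow> std_form X c c = 2"
proof (induction rule: std_roots.induct)
  case (simple_root i)
  then show ?case by (simp add: std_form_unit_vec cartan_matrix_def)
next
  case (simple_reflection c i)
  then have "std_form X (unit_vec i) (unit_vec i) = 2"
    by (simp add: std_form_unit_vec cartan_matrix_def)
  then show ?case
    using simple_reflection std_form_sym[of X c "unit_vec i"]
    unfolding std_form_diff_left std_form_diff_right by (simp add: algebra_simps)
qed

lemma std_roots_supported: "c \<in> std_roots X \<Longrightarrow> supported_on {1..dynkin_rank X} c"
  by (induction rule: std_roots.induct) (auto simp: supported_on_def unit_vec_apply)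

text \<open>Induction along the generation of \<open>c\<close>: the reflection in the image of
  \<open>c\<close> under a simple reflection is the reflection in \<open>c\<close> conjugated by it.
  Below, \<open>d'\<close> and \<open>d''\<close> are the first two stages of this conjugate applied
  to \<open>d\<close>.\<close>

lemma std_roots_reflection:
  "c \<in> std_roots X \<Longrightarrow> d \<in> std_roots X \<Longrightarrow> (\<lambda>j. d j - std_form X d c * c j) \<in> std_roots X"
proof (induction arbitrary: d rule: std_roots.induct)
  case (simple_root i)
  then show ?case by (rule std_roots.simple_reflection[rotated])
next
  case (simple_reflection c i)
  let ?e = "unit_vec i" and ?f = "std_form X"
  have e: "?f ?e ?e = 2"
    using simple_reflection.hyps(2) by (simp add: std_form_unit_vec cartan_matrix_def)
  define d' where "d' = (\<lambda>j. d j - ?f d ?e * ?e j)"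
  define d'' where "d'' = (\<lambda>j. d' j - ?f d' c * c j)"
  have "d' \<in> std_roots X"
    unfolding d'_def using simple_reflection by (intro std_roots.simple_reflection)
  then have "d'' \<in> std_roots X"
    unfolding d''_def by (rule simple_reflection.IH)
  then have "(\<lambda>j. d'' j - ?f d'' ?e * ?e j) \<in> std_roots X"
    using simple_reflection.hyps(2) by (intro std_roots.simple_reflection)
  moreover have "d'' j - ?f d'' ?e * ?e j
      = d j - ?f d (\<lambda>j. c j - ?f c ?e * ?e j) * (c j - ?f c ?e * ?e j)" for j
    unfolding d''_def d'_def std_form_diff_left std_form_diff_right e std_form_sym[of X ?e c]
    by (simp add: algebra_simps)
  ultimately show ?case by simp
qed

lemma std_roots_uminus: "c \<in> std_roots X \<Longrightarrow> (\<lambda>j. - c j) \<in> std_roots X"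
  using std_roots_reflection[of c X c] by (simp add: std_form_root)

lemma int_comb_inj:
  assumes "indep_family l a" "int_comb l a c = int_comb l a d" "i \<in> {1..l}"
  shows "c i = d i"
proof -
  have "(\<Sum>i\<in>{1..l}. of_int (c i - d i) * a i h) = 0" for h
    using fun_cong[OF assms(2), of h] by (simp add: int_comb_def left_diff_distrib sum_subtractf)
  moreover have "(\<forall>h. (\<Sum>i\<in>{1..l}. of_int (c i - d i) * a i h) = 0) \<longrightarrow>
      (\<forall>i\<in>{1..l}. of_int (c i - d i) = (0::complex))"
    using assms(1) unfolding indep_family_def by (rule spec)
  ultimately have "of_int (c i - d i) = (0::complex)" using assms(3) by blast
  then show ?thesis by simp
qed

lemma int_comb_diff: "int_comb l a (\<lambda>j. c j - k * d j) = (\<lambda>h. int_comb l a c h - of_int k * int_comb l a d h)"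
  by (auto simp: int_comb_def left_diff_distrib sum_subtractf sum_distrib_left mult.assoc)

lemma int_comb_uminus: "int_comb l a (\<lambda>j. - c j) = (\<lambda>h. - int_comb l a c h)"
  by (auto simp: int_comb_def sum_negf)

lemma int_comb_unit_vec: "i \<in> {1..l} \<Longrightarrow> int_comb l a (unit_vec i) = a i"
proof
  fix h
  assume "i \<in> {1..l}"
  have "int_comb l a (unit_vec i) h = (\<Sum>k\<in>{1..l}. if k = i then a k h else 0)"
    unfolding int_comb_def unit_vec_apply by (intro sum.cong) auto
  then show "int_comb l a (unit_vec i) h = a i h" using \<open>i \<in> {1..l}\<close> by simp
qed

lemma int_comb_cong: "(\<And>i. i \<in> {1..l} \<Longrightarrow> c i = d i) \<Longrightarrow> int_comb l a c = int_comb l a d"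
  by (auto simp: int_comb_def)

section \<open>Coordinates with respect to the given base\<close>

locale simply_laced_base =
  fixes H :: "'g::complex_lie_algebra set" and X :: dynkin_type and l :: nat
    and a \<alpha> :: "nat \<Rightarrow> 'g \<Rightarrow> complex" and p :: "nat \<Rightarrow> nat \<Rightarrow> int"
  assumes rank: "dynkin_rank X = l"
    and indep: "indep_family l a"
    and roots: "lie_roots H = int_comb l a ` std_roots X"
    and cartan: "\<And>c d. c \<in> std_roots X \<Longrightarrow> d \<in> std_roots X \<Longrightarrow>
      cartan_int H (int_comb l a c) (int_comb l a d) = 2 * of_int (std_form X c d) / of_int (std_form X d d)"
    and base: "is_base H l \<alpha>"
    and p_root: "\<And>i. i \<in> {1..l} \<Longrightarrow> p i \<in> std_roots X"
    and p_eq: "\<And>i. i \<in> {1..l} \<Longrightarrow> \<alpha> i = int_comb l a (p i)"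
begin

text \<open>The change of coordinates from the given base \<alpha> to the family \<open>a\<close>
  that witnesses the type; the two families may differ, and \<open>p i\<close> holds the
  \<open>a\<close>-coordinates of \<alpha> \<open>i\<close>.\<close>

definition lin :: "(nat \<Rightarrow> int) \<Rightarrow> nat \<Rightarrow> int" where
  "lin c = (\<lambda>k. \<Sum>i\<in>{1..l}. c i * p i k)"

definition gram :: "nat \<Rightarrow> nat \<Rightarrow> int" where
  "gram i j = std_form X (p i) (p j)"

definition coords :: "(nat \<Rightarrow> int) set" where
  "coords = {c. supported_on {1..l} c \<and> lin c \<in> std_roots X}"

lemma indep_base: "indep_family l \<alpha>"
  using base by (simp add: is_base_def)

lemma int_comb_lin: "int_comb l \<alpha> c = int_comb l a (lin c)"
proof
  fix h
  have "int_comb l \<alpha> c h = (\<Sum>i\<in>{1..l}. \<Sum>k\<in>{1..l}. of_int (c i) * (of_int (p i k) * a k h))"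
    unfolding int_comb_def[of l \<alpha>] sum_distrib_left[symmetric]
    by (intro sum.cong refl) (simp add: p_eq int_comb_def)
  also have "\<dots> = (\<Sum>k\<in>{1..l}. \<Sum>i\<in>{1..l}. of_int (c i) * (of_int (p i k) * a k h))"
    by (rule sum.swap)
  also have "\<dots> = int_comb l a (lin c) h"
    unfolding int_comb_def lin_def by (simp add: sum_distrib_right mult.assoc)
  finally show "int_comb l \<alpha> c h = int_comb l a (lin c) h" .
qed

lemma lin_diff: "lin (\<lambda>j. c j - k * unit_vec i j) = (\<lambda>j. lin c j - k * p i j)" if "i \<in> {1..l}"
proof
  fix j
  have "(\<Sum>m\<in>{1..l}. unit_vec i m * p m j) = (\<Sum>m\<in>{1..l}. if m = i then p m j else 0)"
    unfolding unit_vec_apply by (intro sum.cong) auto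
  also have "\<dots> = p i j" using that by simp
  finally show "lin (\<lambda>j. c j - k * unit_vec i j) j = lin c j - k * p i j"
    by (simp add: lin_def left_diff_distrib sum_subtractf sum_distrib_left[symmetric] mult.assoc)
qed

lemma std_form_lin: "std_form X (lin c) d = (\<Sum>k\<in>{1..l}. c k * std_form X (p k) d)"
  unfolding lin_def by (rule std_form_sum_left)

lemma lin_supported: "supported_on {1..l} (lin c)"
  using std_roots_supported[OF p_root] rank by (auto simp: lin_def supported_on_def)

text \<open>Independence of \<open>a\<close> makes the \<open>a\<close>-coordinates of a root
  unique, so being a root can be tested on coefficients.\<close>

lemma coords_iff:
  assumes "supported_on {1..l} c"
  shows "c \<in> coords \<longleftrightarrow> int_comb l \<alpha> c \<in> lie_roots H"
proof
  assume "int_comb l \<alpha> c \<in> lie_roots H"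
  then obtain d where d: "d \<in> std_roots X" "int_comb l a (lin c) = int_comb l a d"
    by (auto simp: roots int_comb_lin)
  have "lin c i = d i" for i
    using int_comb_inj[OF indep d(2), of i] lin_supported[of c] std_roots_supported[OF d(1)] rank
    by (cases "i \<in> {1..l}") (auto simp: supported_on_def)
  then have "lin c = d" by auto
  then show "c \<in> coords" using assms d by (simp add: coords_def)
qed (auto simp: coords_def roots int_comb_lin)

lemma int_comb_restrict: "int_comb l b (restrict_to {1..l} c) = int_comb l b c"
  by (intro int_comb_cong) (simp add: restrict_to_def)

lemma restrict_supported: "supported_on S (restrict_to S c)"
  by (simp add: supported_on_def restrict_to_def)

lemma root_coords:
  assumes "\<beta> \<in> lie_roots H"
  obtains c where "c \<in> coords" "\<beta> = int_comb l \<alpha> c" "(\<forall>i. 0 \<le> c i) \<or> (\<forall>i. c i \<le> 0)"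
proof -
  obtain c where c: "\<beta> = int_comb l \<alpha> c" "(\<forall>i\<in>{1..l}. 0 \<le> c i) \<or> (\<forall>i\<in>{1..l}. c i \<le> 0)"
    using base assms unfolding is_base_def by blast
  have eq: "\<beta> = int_comb l \<alpha> (restrict_to {1..l} c)"
    unfolding int_comb_restrict by (rule c(1))
  then have "restrict_to {1..l} c \<in> coords"
    using coords_iff[OF restrict_supported] assms by simp
  moreover have "(\<forall>i. 0 \<le> restrict_to {1..l} c i) \<or> (\<forall>i. restrict_to {1..l} c i \<le> 0)"
    using c(2) by (auto simp: restrict_to_def)
  ultimately show ?thesis using that eq by blast
qed

lemma coords_inj:
  assumes "c \<in> coords" "d \<in> coords" "int_comb l \<alpha> c = int_comb l \<alpha> d"
  shows "c = d"
proof
  fix i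
  show "c i = d i"
    using int_comb_inj[OF indep_base assms(3), of i] assms(1,2)
    by (cases "i \<in> {1..l}") (auto simp: coords_def supported_on_def)
qed

lemma int_comb_coords: "c \<in> coords \<Longrightarrow> int_comb l \<alpha> c \<in> lie_roots H"
  using coords_iff by (auto simp: coords_def)

lemma cartan_int_coords:
  assumes "c \<in> coords" "i \<in> {1..l}"
  shows "cartan_int H (int_comb l \<alpha> c) (\<alpha> i) = of_int (\<Sum>k\<in>{1..l}. c k * gram k i)"
  using cartan[of "lin c" "p i"] assms p_root[of i]
  by (simp add: coords_def int_comb_lin p_eq std_form_root std_form_lin gram_def)

lemma unit_vec_coords: "i \<in> {1..l} \<Longrightarrow> unit_vec i \<in> coords"
  using base coords_iff[of "unit_vec i"] supported_on_unit_vec[of i "{1..l}"]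
  by (simp add: int_comb_unit_vec is_base_def)

lemma gram_eq_0:
  assumes "i \<in> {1..l}" "j \<in> {1..l}" "dual_form H (\<alpha> i) (\<alpha> j) = 0"
  shows "gram i j = 0"
proof -
  have "cartan_int H (\<alpha> i) (\<alpha> j) = of_int (gram i j)"
    using cartan[OF p_root p_root, of i j] assms p_root[of j]
    by (simp add: p_eq std_form_root gram_def)
  then show ?thesis using assms(3) by (simp add: cartan_int_def)
qed

text \<open>The abstract setting is instantiated with coefficients in the given base. The norm and
  the reflections are inherited through \<open>lin\<close> from the standard root system; coherence
  and the dominance of \<psi> come from the definitions of base and highest root.\<close>

lemma bipartite_roots_coords:
  assumes hi: "is_highest_root H l \<alpha> \<psi>" and bi: "is_bipartition H l \<alpha> \<psi> I1 I2"
  shows "\<exists>\<psi>'. bipartite_roots I1 I2 gram coords \<psi>'"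
proof -
  have I: "I1 \<union> I2 = {1..l}" using bi by (simp add: is_bipartition_def)
  obtain \<psi>' where \<psi>': "\<psi>' \<in> coords" "\<psi> = int_comb l \<alpha> \<psi>'"
    using hi by (auto simp: is_highest_root_def elim: root_coords)
  show ?thesis
  proof (intro exI[of _ \<psi>'] bipartite_roots.intro)
    show "finite (I1 \<union> I2)" by (simp add: I)
    show "I1 \<inter> I2 = {}" using bi by (simp add: is_bipartition_def)
    show "gram i j = gram j i" for i j by (simp add: gram_def std_form_sym)
    show "gram i i = 2" if "i \<in> I1 \<union> I2" for i
      using that p_root[of i] by (simp add: I gram_def std_form_root)
    show "gram i j = 0" if "i \<in> I1" "j \<in> I1" "i \<noteq> j" for i j
      using bi that I by (intro gram_eq_0) (auto simp: is_bipartition_def)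
    show "gram i j = 0" if "i \<in> I2" "j \<in> I2" "i \<noteq> j" for i j
      using bi that I by (intro gram_eq_0) (auto simp: is_bipartition_def)
    show "supported_on (I1 \<union> I2) c" if "c \<in> coords" for c
      using that by (simp add: I coords_def)
    show "(\<forall>i. 0 \<le> c i) \<or> (\<forall>i. c i \<le> 0)" if "c \<in> coords" for c
    proof (rule root_coords[OF int_comb_coords[OF that]])
      fix d assume "d \<in> coords" "int_comb l \<alpha> c = int_comb l \<alpha> d"
      then have "c = d" by (rule coords_inj[OF that])
      moreover assume "(\<forall>i. 0 \<le> d i) \<or> (\<forall>i. d i \<le> 0)"
      ultimately show ?thesis by simp
    qed
    show "(\<Sum>i\<in>I1 \<union> I2. (\<Sum>k\<in>I1 \<union> I2. c k * gram k i) * c i) = 2" if "c \<in> coords" for c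
    proof -
      have "std_form X (lin c) (lin c) = (\<Sum>i\<in>{1..l}. c i * std_form X (lin c) (p i))"
        unfolding std_form_lin[of c "lin c"] by (intro sum.cong refl) (simp only: std_form_sym)
      also have "\<dots> = (\<Sum>i\<in>{1..l}. (\<Sum>k\<in>{1..l}. c k * gram k i) * c i)"
        unfolding std_form_lin gram_def by (intro sum.cong refl mult.commute)
      finally show ?thesis
        using that std_form_root[of "lin c" X] by (simp add: I coords_def)
    qed
    show "unit_vec i \<in> coords" if "i \<in> I1 \<union> I2" for i
      using that unit_vec_coords by (simp add: I)
    show "(\<lambda>j. c j - (\<Sum>k\<in>I1 \<union> I2. c k * gram k i) * unit_vec i j) \<in> coords"
      if "c \<in> coords" "i \<in> I1 \<union> I2" for c i
    proof -
      have i: "i \<in> {1..l}" using that I by simp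
      have "(\<lambda>j. lin c j - (\<Sum>k\<in>{1..l}. c k * gram k i) * p i j) \<in> std_roots X"
        using std_roots_reflection[OF p_root[OF i], of "lin c"] that(1)
        by (simp add: coords_def std_form_lin gram_def)
      moreover have "supported_on {1..l} (\<lambda>j. c j - (\<Sum>k\<in>{1..l}. c k * gram k i) * unit_vec i j)"
        using that(1) supported_on_unit_vec[OF i] by (simp add: coords_def supported_on_def)
      ultimately show ?thesis
        unfolding I coords_def mem_Collect_eq lin_diff[OF i] by blast
    qed
    show "(\<lambda>j. - c j) \<in> coords" if "c \<in> coords" for c
    proof -
      have "lin (\<lambda>j. - c j) = (\<lambda>j. - lin c j)" by (auto simp: lin_def sum_negf)
      then show ?thesis using that std_roots_uminus by (simp add: coords_def supported_on_def)
    qed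
    show "\<psi>' \<in> coords" by (rule \<psi>')
    show "c i \<le> \<psi>' i" if c: "c \<in> coords" for c i
    proof (cases "i \<in> {1..l}")
      case True
      obtain d where d: "\<forall>i\<in>{1..l}. 0 \<le> d i" "(\<lambda>h. \<psi> h - int_comb l \<alpha> c h) = int_comb l \<alpha> d"
        using hi int_comb_coords[OF c] unfolding is_highest_root_def by blast
      \<comment> \<open>The factor 1 gives the difference the shape of
        \<open>int_comb_diff\<close>.\<close>
      then have "int_comb l \<alpha> (\<lambda>i. \<psi>' i - 1 * c i) = int_comb l \<alpha> d"
        unfolding int_comb_diff \<psi>'(2) by simp
      then have "\<psi>' i - 1 * c i = d i" using int_comb_inj[OF indep_base _ True] by blast
      then show ?thesis using d(1) True by force
    next
      case False
      then show ?thesis using c \<psi>'(1) by (simp add: coords_def supported_on_def)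
    qed
  qed
qed

end

section \<open>The Coxeter element in coordinates\<close>

locale bipartite_base = simply_laced_base H X l a \<alpha> p + bipartite_roots I1 I2 gram coords \<psi>
  for H :: "'g::complex_lie_algebra set" and X l a \<alpha> p I1 I2 \<psi> +
  assumes index: "I1 \<union> I2 = {1..l}"
begin

lemma root_reflection_coords:
  assumes "c \<in> coords" "i \<in> {1..l}"
  shows "root_reflection H (\<alpha> i) (int_comb l \<alpha> c) = int_comb l \<alpha> (\<lambda>j. c j - pairing c i * unit_vec i j)"
  unfolding root_reflection_def int_comb_diff cartan_int_coords[OF assms] int_comb_unit_vec[OF assms(2)]
  by (simp add: pairing_def index)

text \<open>Peeling off one reflection at a time matches \<open>refl_set_insert\<close>, so for
  orthogonal reflections the order of the list does not affect the result.\<close>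

lemma foldr_reflection_coords:
  assumes "distinct xs" "orthogonal_set (set xs)" "c \<in> coords"
  shows "foldr (\<lambda>i f. root_reflection H (\<alpha> i) \<circ> f) xs id (int_comb l \<alpha> c) = int_comb l \<alpha> (refl_set (set xs) c)"
  using assms
proof (induction xs)
  case Nil
  then show ?case by (simp add: refl_set_def)
next
  case (Cons i xs)
  have xs: "orthogonal_set (set xs)" and i: "i \<in> {1..l}"
    using Cons.prems(2) by (auto simp: orthogonal_set_def index)
  have "refl_set (set xs) c \<in> coords"
    using xs Cons.prems by (intro refl_set_root) auto
  moreover have "refl_set (set (i # xs)) c
      = (\<lambda>j. refl_set (set xs) c j - pairing (refl_set (set xs) c) i * unit_vec i j)"
    using refl_set_insert[of i "set xs" c] Cons.prems by simp
  ultimately show ?case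
    using Cons.IH xs Cons.prems i by (simp add: root_reflection_coords)
qed

lemma coxeter_elt_coords:
  assumes "c \<in> coords"
  shows "coxeter_elt H \<alpha> I1 I2 (int_comb l \<alpha> c) = int_comb l \<alpha> (coxeter c)"
proof -
  have prod: "reflection_prod H \<alpha> S (int_comb l \<alpha> d) = int_comb l \<alpha> (refl_set S d)"
    if "d \<in> coords" "orthogonal_set S" "finite S" for S d
    using foldr_reflection_coords[of "sorted_list_of_set S" d] that by (simp add: reflection_prod_def)
  have "refl_set I1 c \<in> coords"
    using assms by (intro refl_set_root finite_I1 orthogonal_I1)
  then show ?thesis
    using assms by (simp add: coxeter_elt_def coxeter_def prod finite_I1 finite_I2 orthogonal_I1 orthogonal_I2)
qed

lemma coxeter_elt_funpow_coords:
  "c \<in> coords \<Longrightarrow> (coxeter_elt H \<alpha> I1 I2 ^^ m) (int_comb l \<alpha> c) = int_comb l \<alpha> ((coxeter ^^ m) c)"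
  by (induction m) (simp_all add: coxeter_elt_coords coxeter_funpow_root)

lemma beta_coords: "i \<in> {1..l} \<Longrightarrow> beta \<alpha> I1 i = int_comb l \<alpha> (signed_unit i)"
  by (simp add: beta_def signed_unit_def int_comb_uminus int_comb_unit_vec)

lemma coxeter_elt_funpow_eq_beta_iff:
  assumes "c \<in> coords" "i \<in> {1..l}"
  shows "(coxeter_elt H \<alpha> I1 I2 ^^ m) (int_comb l \<alpha> c) = beta \<alpha> I1 i \<longleftrightarrow> (coxeter ^^ m) c = signed_unit i"
  using coords_inj[OF coxeter_funpow_root[OF assms(1)] signed_unit_root] assms
  by (auto simp: coxeter_elt_funpow_coords beta_coords index)

lemma positive_root_coords:
  assumes "\<phi> \<in> positive_roots H l \<alpha>"
  obtains c where "c \<in> coords" "\<And>i. 0 \<le> c i" "\<phi> = int_comb l \<alpha> c"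
proof -
  obtain c where c: "\<forall>i\<in>{1..l}. 0 \<le> c i" "\<phi> = int_comb l \<alpha> c" "\<phi> \<in> lie_roots H"
    using assms by (auto simp: positive_roots_def)
  have "\<phi> = int_comb l \<alpha> (restrict_to {1..l} c)" unfolding int_comb_restrict by (rule c(2))
  moreover have "restrict_to {1..l} c \<in> coords"
    unfolding coords_iff[OF restrict_supported] int_comb_restrict using c(2,3) by simp
  moreover have "0 \<le> restrict_to {1..l} c i" for i using c(1) by (simp add: restrict_to_def)
  ultimately show ?thesis using that by blast
qed

theorem exists_unique_steps:
  assumes \<phi>: "\<phi> \<in> positive_roots H l \<alpha>"
  defines "\<sigma> \<equiv> coxeter_elt H \<alpha> I1 I2" and "k \<equiv> root_colour H l \<alpha> I1 I2 \<phi>"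
    and "b \<equiv> beta \<alpha> I1 (root_index H l \<alpha> I1 I2 \<phi>)"
  shows "\<exists>!n. 1 \<le> n \<and> n \<le> coxeter_number H \<alpha> I1 I2 \<and> (even n \<longleftrightarrow> even k) \<and>
    (k = 1 \<longrightarrow> (\<sigma> ^^ ((n - 1) div 2)) \<phi> = b) \<and> (k = 2 \<longrightarrow> (\<sigma> ^^ (n div 2)) \<phi> = b)"
proof -
  obtain N where N: "0 < N" and period: "\<And>c. c \<in> coords \<Longrightarrow> (coxeter ^^ N) c = c"
    and orbit: "\<And>c. c \<in> coords \<Longrightarrow> (\<And>i. 0 \<le> c i) \<Longrightarrow>
      \<exists>n j. 1 \<le> n \<and> n \<le> N \<and> j \<in> I \<and> (odd n \<longleftrightarrow> j \<in> I1) \<and> (coxeter ^^ (n div 2)) c = signed_unit j \<and>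
        (\<forall>m. \<forall>i\<in>I. (coxeter ^^ m) c = signed_unit i \<longrightarrow>
          i = j \<and> 2 * N dvd 2 * m + (if i \<in> I1 then 1 else 0) + 2 * N - n)"
    by (rule coxeter_orbits) iprover
  have number: "coxeter_number H \<alpha> I1 I2 = N"
    unfolding coxeter_number_def
  proof (rule Least_equality)
    have "(coxeter_elt H \<alpha> I1 I2 ^^ N) \<beta> = \<beta>" if "\<beta> \<in> lie_roots H" for \<beta>
      using root_coords[OF that] by (metis coxeter_elt_funpow_coords period)
    then show "0 < N \<and> (\<forall>\<phi>\<in>lie_roots H. (coxeter_elt H \<alpha> I1 I2 ^^ N) \<phi> = \<phi>)"
      using N by blast
  next
    \<comment> \<open>If the \<open>m\<close>-th power also fixes every root, \<psi> reaches the
      same signed simple root after \<open>n div 2\<close> and after \<open>n div 2 + m\<close>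
      applications. Both positions are determined modulo \<open>2 * N\<close>, so
      \<open>2 * N\<close> divides their difference \<open>2 * m\<close>.\<close>
    fix m assume m: "0 < m \<and> (\<forall>\<phi>\<in>lie_roots H. (coxeter_elt H \<alpha> I1 I2 ^^ m) \<phi> = \<phi>)"
    obtain n j where j: "j \<in> I" and n: "n \<le> N" and nj: "(coxeter ^^ (n div 2)) \<psi> = signed_unit j"
      and unique: "\<And>m i. i \<in> I \<Longrightarrow> (coxeter ^^ m) \<psi> = signed_unit i \<Longrightarrow>
        2 * N dvd 2 * m + (if i \<in> I1 then 1 else 0) + 2 * N - n"
      using orbit[OF highest_root highest_nonneg] by blast
    have "int_comb l \<alpha> ((coxeter ^^ m) \<psi>) = int_comb l \<alpha> \<psi>"
      using m int_comb_coords[OF highest_root] coxeter_elt_funpow_coords[OF highest_root, of m] by simp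
    then have "(coxeter ^^ m) \<psi> = \<psi>"
      by (intro coords_inj coxeter_funpow_root highest_root)
    then have "(coxeter ^^ (n div 2 + m)) \<psi> = signed_unit j"
      using nj by (simp add: funpow_add)
    then have "2 * N dvd 2 * (n div 2 + m) + (if j \<in> I1 then 1 else 0) + 2 * N - n"
      using unique j by blast
    moreover have "2 * N dvd 2 * (n div 2) + (if j \<in> I1 then 1 else 0) + 2 * N - n"
      using unique j nj by blast
    moreover have "2 * (n div 2 + m) + (if j \<in> I1 then 1 else 0) + 2 * N - n
        = (2 * (n div 2) + (if j \<in> I1 then 1 else 0) + 2 * N - n) + 2 * m"
      using n by simp
    ultimately have "2 * N dvd 2 * m"
      by (metis dvd_add_right_iff)
    then show "N \<le> m" using m by (auto dest: dvd_imp_le)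
  qed
  obtain c where c: "c \<in> coords" "\<And>i. 0 \<le> c i" "\<phi> = int_comb l \<alpha> c"
    using positive_root_coords[OF \<phi>] by blast
  obtain n j where n: "1 \<le> n" "n \<le> N" and j: "j \<in> {1..l}" and parity: "odd n \<longleftrightarrow> j \<in> I1"
    and nj: "(coxeter ^^ (n div 2)) c = signed_unit j"
    and unique: "\<And>m i. i \<in> {1..l} \<Longrightarrow> (coxeter ^^ m) c = signed_unit i \<Longrightarrow>
      i = j \<and> 2 * N dvd 2 * m + (if i \<in> I1 then 1 else 0) + 2 * N - n"
    using orbit[OF c(1,2)] unfolding index by blast
  have \<sigma>_iff: "(\<sigma> ^^ m) \<phi> = beta \<alpha> I1 i \<longleftrightarrow> (coxeter ^^ m) c = signed_unit i" if "i \<in> {1..l}" for m i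
    unfolding \<sigma>_def c(3) using c(1) that by (rule coxeter_elt_funpow_eq_beta_iff)
  have index_eq: "root_index H l \<alpha> I1 I2 \<phi> = j"
    unfolding root_index_def
  proof (rule the_equality)
    show "j \<in> {1..l} \<and> \<phi> \<in> positive_roots H l \<alpha> \<inter> cyclic_orbit (coxeter_elt H \<alpha> I1 I2) (beta \<alpha> I1 j)"
      using \<phi> j nj \<sigma>_iff[OF j] by (auto simp: cyclic_orbit_def \<sigma>_def)
  next
    fix i assume i: "i \<in> {1..l} \<and> \<phi> \<in> positive_roots H l \<alpha> \<inter> cyclic_orbit (coxeter_elt H \<alpha> I1 I2) (beta \<alpha> I1 i)"
    then obtain m where "\<phi> = (\<sigma> ^^ m) (beta \<alpha> I1 i) \<or> (\<sigma> ^^ m) \<phi> = beta \<alpha> I1 i"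
      by (auto simp: cyclic_orbit_def \<sigma>_def)
    then show "i = j"
    proof
      assume "(\<sigma> ^^ m) \<phi> = beta \<alpha> I1 i"
      then show ?thesis using \<sigma>_iff unique i by blast
    next
      \<comment> \<open>Here \<phi> lies ahead of the signed simple root. As the \<open>N\<close>-th
        power is the identity on roots, \<open>N * m - m\<close> further applications close the
        cycle and reduce this to a forward return.\<close>
      assume *: "\<phi> = (\<sigma> ^^ m) (beta \<alpha> I1 i)"
      have s: "signed_unit i \<in> coords" using i signed_unit_root index by simp
      have "int_comb l \<alpha> c = int_comb l \<alpha> ((coxeter ^^ m) (signed_unit i))"
        using * i s by (simp add: c(3) \<sigma>_def beta_coords coxeter_elt_funpow_coords)
      then have cm: "c = (coxeter ^^ m) (signed_unit i)"
        using c(1) s by (intro coords_inj coxeter_funpow_root)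
      have "(coxeter ^^ (N * q)) (signed_unit i) = signed_unit i" for q
        by (induction q) (simp_all add: funpow_add period[OF s])
      moreover have "N * m - m + m = N * m" using N by simp
      ultimately have "(coxeter ^^ (N * m - m)) c = signed_unit i"
        unfolding cm by (metis funpow_add comp_apply)
      then show ?thesis using unique i by blast
    qed
  qed
  have k: "k = (if j \<in> I1 then 1 else 2)"
    by (simp add: k_def root_colour_def index_eq)
  \<comment> \<open>For odd exponents the two formulas of the statement have the same value, so
    \<open>n div 2\<close> serves both colours.\<close>
  have half: "(m - 1) div 2 = m div 2" if "odd m" for m :: nat
    using that by (auto elim!: oddE)
  show ?thesis
    unfolding number b_def index_eq
  proof (rule ex1I[of _ n])
    show "1 \<le> n \<and> n \<le> N \<and> (even n \<longleftrightarrow> even k) \<and>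
      (k = 1 \<longrightarrow> (\<sigma> ^^ ((n - 1) div 2)) \<phi> = beta \<alpha> I1 j) \<and> (k = 2 \<longrightarrow> (\<sigma> ^^ (n div 2)) \<phi> = beta \<alpha> I1 j)"
      using n parity nj \<sigma>_iff[OF j] half[of n] by (cases "j \<in> I1") (simp_all add: k)
  next
    fix n' assume n': "1 \<le> n' \<and> n' \<le> N \<and> (even n' \<longleftrightarrow> even k) \<and>
      (k = 1 \<longrightarrow> (\<sigma> ^^ ((n' - 1) div 2)) \<phi> = beta \<alpha> I1 j) \<and> (k = 2 \<longrightarrow> (\<sigma> ^^ (n' div 2)) \<phi> = beta \<alpha> I1 j)"
    then have parity': "odd n' \<longleftrightarrow> j \<in> I1" by (simp add: k)
    have "(coxeter ^^ (n' div 2)) c = signed_unit j"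
      using n' parity' \<sigma>_iff[OF j] half[of n'] by (cases "j \<in> I1") (simp_all add: k)
    then have "2 * N dvd 2 * (n' div 2) + (if j \<in> I1 then 1 else 0) + 2 * N - n"
      using unique[OF j] by blast
    moreover have "2 * (n' div 2) + (if j \<in> I1 then 1 else 0) = n'"
      using parity' by (cases "odd n'") auto
    ultimately have "2 * N dvd n' + 2 * N - n" by simp
    then obtain q where q: "n' + 2 * N - n = 2 * N * q" by blast
    \<comment> \<open>Both \<open>n\<close> and \<open>n'\<close> lie between 1 and
      \<open>N\<close>, so \<open>n' + 2 * N - n\<close> lies strictly between 0 and
      \<open>4 * N\<close>; the only multiple of \<open>2 * N\<close> there is \<open>2 * N\<close>
      itself.\<close>
    have "q = 1"
    proof -
      have "0 < 2 * N * q" "2 * N * q < 2 * N * 2" using n n' N q by linarith+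
      then have "0 < q" "q < 2" by auto
      then show ?thesis by simp
    qed
    then show "n' = n" using q n by simp
  qed
qed

end

theorem theorem1p11:
  fixes H :: "'g::simple_complex_lie_algebra set"
    and X :: dynkin_type
    and \<alpha> :: "nat \<Rightarrow> 'g \<Rightarrow> complex"
    and \<psi> \<phi> :: "'g \<Rightarrow> complex"
    and l h :: nat
    and I1 I2 :: "nat set"
    and \<sigma> :: "('g \<Rightarrow> complex) \<Rightarrow> ('g \<Rightarrow> complex)"
  assumes "cartan_subalgebra H"
    and "(X = Type_A l \<and> odd l) \<or> (X = Type_D l \<and> 4 \<le> l) \<or> (X = Type_E l \<and> l \<in> {6, 7, 8})"
    and "has_type H X"
    and "is_base H l \<alpha>"
    and "is_highest_root H l \<alpha> \<psi>"
    and "is_bipartition H l \<alpha> \<psi> I1 I2"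
    and "\<sigma> = coxeter_elt H \<alpha> I1 I2"
    and "h = coxeter_number H \<alpha> I1 I2"
    and "\<phi> \<in> positive_roots H l \<alpha>"
  shows "\<exists>!n::nat. 1 \<le> n \<and> n \<le> h \<and> (even n \<longleftrightarrow> even (root_colour H l \<alpha> I1 I2 \<phi>)) \<and>
    (root_colour H l \<alpha> I1 I2 \<phi> = 1 \<longrightarrow>
       (\<sigma> ^^ ((n - 1) div 2)) \<phi> = beta \<alpha> I1 (root_index H l \<alpha> I1 I2 \<phi>)) \<and>
    (root_colour H l \<alpha> I1 I2 \<phi> = 2 \<longrightarrow>
       (\<sigma> ^^ (n div 2)) \<phi> = beta \<alpha> I1 (root_index H l \<alpha> I1 I2 \<phi>))"
proof -
  have rank: "dynkin_rank X = l" using assms(2) by auto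
  obtain a where a: "indep_family l a" "lie_roots H = int_comb l a ` std_roots X"
    "\<And>c d. c \<in> std_roots X \<Longrightarrow> d \<in> std_roots X \<Longrightarrow>
      cartan_int H (int_comb l a c) (int_comb l a d) = 2 * of_int (std_form X c d) / of_int (std_form X d d)"
    using assms(3) unfolding has_type_def rank by blast
  \<comment> \<open>The simple roots of the given base are roots, so each has standard coordinates;
    choosing them supplies the change of basis \<open>p\<close>.\<close>
  have "\<forall>i\<in>{1..l}. \<exists>c. c \<in> std_roots X \<and> \<alpha> i = int_comb l a c"
    using assms(4) a(2) by (auto simp: is_base_def)
  then obtain p where p: "\<And>i. i \<in> {1..l} \<Longrightarrow> p i \<in> std_roots X" "\<And>i. i \<in> {1..l} \<Longrightarrow> \<alpha> i = int_comb l a (p i)"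
    by metis
  have base: "simply_laced_base H X l a \<alpha> p"
    using rank a assms(4) p by (rule simply_laced_base.intro)
  obtain \<psi>' where \<psi>': "bipartite_roots I1 I2 (simply_laced_base.gram X p) (simply_laced_base.coords X l p) \<psi>'"
    using simply_laced_base.bipartite_roots_coords[OF base assms(5,6)] by blast
  interpret bipartite_base H X l a \<alpha> p I1 I2 \<psi>'
    using base \<psi>' assms(6)
    by (intro bipartite_base.intro bipartite_base_axioms.intro) (auto simp: is_bipartition_def)
  show ?thesis
    unfolding assms(7,8) using assms(9) by (rule exists_unique_steps)
qed

end
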